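(* Let $J:\mathcal Z\to\mathbb R$ be the functional defined in the context and let $Z^n=(A_n,B_n,x_n(\cdot),w_n(\cdot))\in\mathcal Z$, $n\ge 0$, be the sequence generated by the following alternating minimization, initialized with $(A_0,B_0)$ (the given prior matrices): for every $n\ge 0$, - $(x_n(\cdot),w_n(\cdot))$ is the unique minimizer of $(x(\cdot),w(\cdot))\mapsto K(A_n,B_n;x(\cdot),w(\cdot))$ over $H^1(0,T;\mathbb R^N)\times L^2(0,T;\mathbb R^m)$; - $(A_{n+1},B_{n+1})$ is the unique minimizer of $(A,B)\mapsto L(A,B;x_n(\cdot),w_n(\cdot))$ over $\mathcal L(\mathbb R^N;\mathbb R^N)\times\mathcal L(\mathbb R^d;\mathbb R^N)$. Then: (1) The sequence $J(Z^n)$ is decreasing (in the sense $J(Z^{n+1})\le J(Z^n)$ for all $n\geq 0$). (2) The sequence $(Z^n)_n$ is bounded in $\mathcal Z$ and $Z^{n+1}-Z^n\to 0$ in $\mathcal Z$. (3) If $\widehat Z=(\widehat A,\widehat B,\widehat x(\cdot),\widehat w(\cdot))$ is the limit of a converging subsequence of $(Z^n)_n$, then $\widehat Z$ is a solution of the following set of necessary optimality conditions: with $$\widehat q(t)=-\beta\left(\frac{d\widehat x}{dt}(t)-\widehat A\widehat x(t)-\widehat B v(t)-G\widehat w(t)\right),$$ one has $$\frac{d\widehat x}{dt}=\widehat A\widehat x(t)+\widehat B v(t)-\left(GQG^*+\frac{I}{\beta}\right)\widehat q(t),\qquad \widehat x(0)=x_0-\Pi_0\widehat q(0),$$ $$-\frac{d\widehat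 q}{dt}=\widehat A^*\widehat q(t)-C^*R^{-1}(y(t)-C\widehat x(t)),\qquad \widehat q(T)=0,$$ $$\alpha(\widehat A-A_0)+\int_0^T\widehat q(t)\widehat x^*(t)\,dt=0,\qquad \alpha(\widehat B-B_0)+\int_0^T\widehat q(t)v^*(t)\,dt=0,$$ with $\widehat w(t)=-QG^*\widehat q(t)$.
   Context: Fix $T>0$, dimensions $N,d,m,p$, and parameters $\alpha,\beta>0$. The following data are given: matrices $A_0\in\mathcal L(\mathbb R^N;\mathbb R^N)$, $B_0\in\mathcal L(\mathbb R^d;\mathbb R^N)$, $G\in\mathcal L(\mathbb R^m;\mathbb R^N)$, $C\in\mathcal L(\mathbb R^N;\mathbb R^p)$; a vector $x_0\in\mathbb R^N$; covariance matrices (symmetric positive semidefinite), assumed invertible, $\Pi_0$ (of size $N\times N$), $Q$ (of size $m\times m$), $R$ (of size $p\times p$); and functions $v\in L^2(0,T;\mathbb R^d)$ and $y\in L^2(0,T;\mathbb R^p)$. Here $\mathcal L(E;F)$ is the space of linear maps from $E$ to $F$, $^*$ denotes transposition, a dot denotes the Euclidean inner product, $|\cdot|$ the Euclidean norm. The Hilbert space $\mathcal Z$ consists of all $Z=(A,B,x(\cdot),w(\cdot))$ with $A\in\mathcal L(\mathbb R^N;\mathbb R^N)$, $B\in\mathcal L(\mathbb R^d;\mathbb R^N)$, $x(\cdot)\in H^1(0,T;\mathbb R^N)$, $w(\cdot)\in L^2(0,T;\mathbb R^m)$, with norm $$\|Z\|^2=\operatorname{tr}(AA^*+BB^* )+|x(0)|^2+\int_0^T\left|\frac{dx}{dt}\right|^2dt+\int_0^T|w(t)|^2dt.$$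 The functional $J:\mathcal Z\to\mathbb R$ is $$J(A,B,x(\cdot),w(\cdot))=\frac{\alpha}{2}\operatorname{tr}\big((A-A_0)(A-A_0)^*+(B-B_0)(B-B_0)^*\big)+\frac{\beta}{2}\int_0^T\left|\frac{dx}{dt}-Ax(t)-Bv(t)-Gw(t)\right|^2dt$$ $$+\frac12\Pi_0^{-1}(x(0)-x_0)\cdot(x(0)-x_0)+\frac12\int_0^TQ^{-1}w(t)\cdot w(t)\,dt+\frac12\int_0^TR^{-1}(y(t)-Cx(t))\cdot(y(t)-Cx(t))\,dt.$$ The two partial functionals are $$K(A,B;x(\cdot),w(\cdot))=\frac12\Pi_0^{-1}(x(0)-x_0)\cdot(x(0)-x_0)+\frac{\beta}{2}\int_0^T\left|\frac{dx}{dt}-Ax(t)-Bv(t)-Gw(t)\right|^2dt$$ $$+\frac12\int_0^TQ^{-1}w(t)\cdot w(t)\,dt+\frac12\int_0^TR^{-1}(y(t)-Cx(t))\cdot(y(t)-Cx(t))\,dt,$$ $$L(A,B;x(\cdot),w(\cdot))=\frac{\alpha}{2}\operatorname{tr}\big((A-A_0)(A-A_0)^*+(B-B_0)(B-B_0)^*\big)+\frac{\beta}{2}\int_0^T\left|\frac{dx}{dt}-Ax(t)-Bv(t)-Gw(t)\right|^2dt.$$ For fixed first (resp. last) two arguments, minimizing $K$ in $(x,w)$ (resp. $L$ in $(A,B)$) is a convex quadratic problem with a unique solution. *)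

theory Defs
  imports "HOL-Analysis.Analysis"
begin

text \<open>
  Elements of \<open>L\<^sup>2(0,T)\<close> are represented by functions on the real line; only the values on
  \<open>{0..T}\<close> matter, and two functions that agree almost everywhere on \<open>{0..T}\<close> represent the same
  element.
\<close>

definition L2_space :: "real \<Rightarrow> (real \<Rightarrow> 'a::euclidean_space) set" where
  "L2_space T = {f. f \<in> borel_measurable (lebesgue_on {0..T}) \<and>
                    integrable (lebesgue_on {0..T}) (\<lambda>t. (norm (f t))\<^sup>2)}"

text \<open>
  The test functions are \<open>C\<^sup>1\<close> with compact support in the open interval \<open>(0,T)\<close>. By mollification
  they give the same weak derivative as \<open>C\<^sup>\<infinity>\<close> test functions.
\<close>

definition test_functions :: "real \<Rightarrow> (real \<Rightarrow> real) set" where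
  "test_functions T = {\<phi>. \<phi> C1_differentiable_on UNIV \<and>
     (\<exists>a b. 0 < a \<and> b < T \<and> (\<forall>t. t \<notin> {a..b} \<longrightarrow> \<phi> t = 0))}"

definition is_weak_derivative ::
    "real \<Rightarrow> (real \<Rightarrow> 'a::euclidean_space) \<Rightarrow> (real \<Rightarrow> 'a) \<Rightarrow> bool" where
  "is_weak_derivative T x g \<longleftrightarrow> g \<in> L2_space T \<and>
     (\<forall>\<phi>\<in>test_functions T.
        (LINT t|lebesgue_on {0..T}. deriv \<phi> t *\<^sub>R x t) =
        - (LINT t|lebesgue_on {0..T}. \<phi> t *\<^sub>R g t))"

text \<open>
  An element of \<open>H\<^sup>1(0,T)\<close> is represented by its continuous representative on \<open>{0..T}\<close>, so that
  its values at \<open>0\<close> and \<open>T\<close> make sense.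
\<close>

definition H1_space :: "real \<Rightarrow> (real \<Rightarrow> 'a::euclidean_space) set" where
  "H1_space T = {x. continuous_on {0..T} x \<and> (\<exists>g. is_weak_derivative T x g)}"

text \<open>
  A representative of the weak derivative; it is determined only up to equality almost everywhere
  on \<open>{0..T}\<close>, and all uses below are insensitive to the choice.
\<close>

definition wderiv :: "real \<Rightarrow> (real \<Rightarrow> 'a::euclidean_space) \<Rightarrow> real \<Rightarrow> 'a" where
  "wderiv T x = (SOME g. is_weak_derivative T x g)"

type_synonym ('n, 'd, 'm) quad =
  "(real^'n^'n) \<times> (real^'d^'n) \<times> (real \<Rightarrow> real^'n) \<times> (real \<Rightarrow> real^'m)"

definition Z_space :: "real \<Rightarrow> ('n::finite, 'd::finite, 'm::finite) quad set" where
  "Z_space T = UNIV \<times> UNIV \<times> H1_space T \<times> L2_space T"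

definition Z_norm :: "real \<Rightarrow> ('n::finite, 'd::finite, 'm::finite) quad \<Rightarrow> real" where
  "Z_norm T = (\<lambda>(A, B, x, w). sqrt (
      trace (A ** transpose A + B ** transpose B)
      + (norm (x 0))\<^sup>2
      + (LINT t|lebesgue_on {0..T}. (norm (wderiv T x t))\<^sup>2)
      + (LINT t|lebesgue_on {0..T}. (norm (w t))\<^sup>2)))"

definition covariance_matrix :: "real^'k^'k \<Rightarrow> bool" where
  "covariance_matrix P \<longleftrightarrow> transpose P = P \<and> (\<forall>u. 0 \<le> (P *v u) \<bullet> u)"

definition residual ::
    "real \<Rightarrow> real^'m^'n \<Rightarrow> (real \<Rightarrow> real^'d) \<Rightarrow> ('n, 'd, 'm) quad \<Rightarrow> real \<Rightarrow> real^'n" where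
  "residual T G v = (\<lambda>(A, B, x, w) t. wderiv T x t - A *v x t - B *v v t - G *v w t)"

definition J_functional ::
    "real \<Rightarrow> real \<Rightarrow> real \<Rightarrow> real^'n^'n \<Rightarrow> real^'d^'n \<Rightarrow> real^'m^'n \<Rightarrow> real^'n^'p \<Rightarrow>
     real^'n \<Rightarrow> real^'n^'n \<Rightarrow> real^'m^'m \<Rightarrow> real^'p^'p \<Rightarrow>
     (real \<Rightarrow> real^'d) \<Rightarrow> (real \<Rightarrow> real^'p) \<Rightarrow> ('n, 'd, 'm) quad \<Rightarrow> real" where
  "J_functional T \<alpha> \<beta> A0 B0 G C x0 \<Pi>0 Q R v y = (\<lambda>(A, B, x, w).
      \<alpha> / 2 * trace ((A - A0) ** transpose (A - A0) + (B - B0) ** transpose (B - B0))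
    + \<beta> / 2 * (LINT t|lebesgue_on {0..T}. (norm (residual T G v (A, B, x, w) t))\<^sup>2)
    + 1 / 2 * ((matrix_inv \<Pi>0 *v (x 0 - x0)) \<bullet> (x 0 - x0))
    + 1 / 2 * (LINT t|lebesgue_on {0..T}. (matrix_inv Q *v w t) \<bullet> w t)
    + 1 / 2 * (LINT t|lebesgue_on {0..T}.
                 (matrix_inv R *v (y t - C *v x t)) \<bullet> (y t - C *v x t)))"

definition K_functional ::
    "real \<Rightarrow> real \<Rightarrow> real^'m^'n \<Rightarrow> real^'n^'p \<Rightarrow>
     real^'n \<Rightarrow> real^'n^'n \<Rightarrow> real^'m^'m \<Rightarrow> real^'p^'p \<Rightarrow>
     (real \<Rightarrow> real^'d) \<Rightarrow> (real \<Rightarrow> real^'p) \<Rightarrow> ('n, 'd, 'm) quad \<Rightarrow> real" where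
  "K_functional T \<beta> G C x0 \<Pi>0 Q R v y = (\<lambda>(A, B, x, w).
      1 / 2 * ((matrix_inv \<Pi>0 *v (x 0 - x0)) \<bullet> (x 0 - x0))
    + \<beta> / 2 * (LINT t|lebesgue_on {0..T}. (norm (residual T G v (A, B, x, w) t))\<^sup>2)
    + 1 / 2 * (LINT t|lebesgue_on {0..T}. (matrix_inv Q *v w t) \<bullet> w t)
    + 1 / 2 * (LINT t|lebesgue_on {0..T}.
                 (matrix_inv R *v (y t - C *v x t)) \<bullet> (y t - C *v x t)))"

definition L_functional ::
    "real \<Rightarrow> real \<Rightarrow> real \<Rightarrow> real^'n^'n \<Rightarrow> real^'d^'n \<Rightarrow> real^'m^'n \<Rightarrow>
     (real \<Rightarrow> real^'d) \<Rightarrow> ('n, 'd, 'm) quad \<Rightarrow> real" where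
  "L_functional T \<alpha> \<beta> A0 B0 G v = (\<lambda>(A, B, x, w).
      \<alpha> / 2 * trace ((A - A0) ** transpose (A - A0) + (B - B0) ** transpose (B - B0))
    + \<beta> / 2 * (LINT t|lebesgue_on {0..T}. (norm (residual T G v (A, B, x, w) t))\<^sup>2))"

text \<open>
  Uniqueness of a minimizer is meant in the function space, hence relative to the equality \<open>eq\<close>
  of that space.
\<close>

definition is_unique_minimizer ::
    "('a \<Rightarrow> 'a \<Rightarrow> bool) \<Rightarrow> ('a \<Rightarrow> real) \<Rightarrow> 'a set \<Rightarrow> 'a \<Rightarrow> bool" where
  "is_unique_minimizer eq f S z \<longleftrightarrow>
     is_arg_min f (\<lambda>u. u \<in> S) z \<and> (\<forall>u. is_arg_min f (\<lambda>u. u \<in> S) u \<longrightarrow> eq u z)"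

definition same_state_noise ::
    "real \<Rightarrow> (real \<Rightarrow> 'a) \<times> (real \<Rightarrow> 'b) \<Rightarrow> (real \<Rightarrow> 'a) \<times> (real \<Rightarrow> 'b) \<Rightarrow> bool" where
  "same_state_noise T = (\<lambda>(x, w) (x', w').
     (\<forall>t\<in>{0..T}. x t = x' t) \<and> (AE t in lebesgue_on {0..T}. w t = w' t))"

definition outer_product :: "real^'n \<Rightarrow> real^'k \<Rightarrow> real^'k^'n" where
  "outer_product a b = (\<chi> i j. a $ i * b $ j)"

text \<open>
  The adjoint state \<open>q\<close> is defined almost everywhere by the first clause after \<open>q \<in> H1_space T\<close>;
  that it has a representative in \<open>H\<^sup>1(0,T)\<close>, which gives a meaning to \<open>q 0\<close>, \<open>q T\<close> and
  \<open>dq/dt\<close>, is part of the assertion.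
\<close>

definition optimality_conditions ::
    "real \<Rightarrow> real \<Rightarrow> real \<Rightarrow> real^'n^'n \<Rightarrow> real^'d^'n \<Rightarrow> real^'m^'n \<Rightarrow> real^'n^'p \<Rightarrow>
     real^'n \<Rightarrow> real^'n^'n \<Rightarrow> real^'m^'m \<Rightarrow> real^'p^'p \<Rightarrow>
     (real \<Rightarrow> real^'d) \<Rightarrow> (real \<Rightarrow> real^'p) \<Rightarrow> ('n, 'd, 'm) quad \<Rightarrow> bool" where
  "optimality_conditions T \<alpha> \<beta> A0 B0 G C x0 \<Pi>0 Q R v y = (\<lambda>(A, B, x, w).
     \<exists>q. q \<in> H1_space T \<and>
       (AE t in lebesgue_on {0..T}. q t = - \<beta> *\<^sub>R (wderiv T x t - A *v x t - B *v v t - G *v w t)) \<and>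
       (AE t in lebesgue_on {0..T}. wderiv T x t =
          A *v x t + B *v v t - (G ** Q ** transpose G + (1 / \<beta>) *\<^sub>R mat 1) *v q t) \<and>
       x 0 = x0 - \<Pi>0 *v q 0 \<and>
       (AE t in lebesgue_on {0..T}. - wderiv T q t =
          transpose A *v q t - (transpose C ** matrix_inv R) *v (y t - C *v x t)) \<and>
       q T = 0 \<and>
       \<alpha> *\<^sub>R (A - A0) + (LINT t|lebesgue_on {0..T}. outer_product (q t) (x t)) = 0 \<and>
       \<alpha> *\<^sub>R (B - B0) + (LINT t|lebesgue_on {0..T}. outer_product (q t) (v t)) = 0 \<and>
       (AE t in lebesgue_on {0..T}. w t = - ((Q ** transpose G) *v q t)))"

end

theory Submission
  imports Defs
begin

text \<open>
  Each half step minimizes a quadratic functional exactly, so it lowers \<open>J\<close> by precisely the quadratic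
  part evaluated at the increment. As \<open>J \<ge> 0\<close>, the decrements tend to zero, and they
  control the increments of \<open>A\<close>, \<open>B\<close>, \<open>x 0\<close>, \<open>w\<close> and of the residual; Gronwall's inequality
  transfers this to \<open>dx/dt\<close>. Boundedness follows in the same way from \<open>J (Z n) \<le> J (Z 0)\<close>.
  Since successive iterates approach each other, the two stationarity conditions, which hold at
  \<open>(A n, B n, x n, w n)\<close> and \<open>(A (n + 1), B (n + 1), x n, w n)\<close> respectively, both pass to the limit along
  a subsequence, and stationarity in \<open>x\<close> yields the adjoint equation by integration by parts.
\<close>

section \<open>The space \<open>L\<^sup>2(0,T)\<close>\<close>

text \<open>The cost controls the residual of the dynamics, not \<open>dx/dt\<close> itself, and the
  linear part \<open>dyn A h k\<close> of the residual changes with the iterate \<open>A n\<close>.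
  The estimates therefore involve \<open>A n\<close> only through an upper bound for its norm, so
  that boundedness of the matrices makes the Gronwall constant uniform in \<open>n\<close>. The
  other obstacle is the function space: \<open>H1_space\<close> is given by weak derivatives,
  \<open>wderiv\<close> is a mere choice, and functions are not identified modulo null sets.
  Everything is transferred to \<open>H1_pair\<close>, where a state is the indefinite integral of
  its derivative; the product rule, Gronwall's inequality and uniqueness of the derivative are
  proved in that form. The subsequence converges in norm, so products such as \<open>A *v x\<close>
  and the inner products pass to the limit directly.\<close>

lemma norm_matrix_vector_mult_le:
  fixes A :: "real^'n^'m"
  shows "norm (A *v u) \<le> norm A * norm u"
proof -
  have "norm (A *v u) = L2_set (\<lambda>i. norm ((A *v u) $ i)) UNIV"
    by (simp add: norm_vec_def)
  also have "\<dots> \<le> L2_set (\<lambda>i. norm (A $ i) * norm u) UNIV"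
    by (intro L2_set_mono) (auto simp: matrix_vector_mul_component Cauchy_Schwarz_ineq2)
  also have "\<dots> = norm A * norm u"
    by (simp add: norm_vec_def[of A] L2_set_left_distrib)
  finally show ?thesis .
qed

lemma matrix_vector_mult_uminus:
  fixes A :: "real^'n^'m"
  shows "A *v (- u) = - (A *v u)" "(- A) *v u = - (A *v u)"
  using matrix_vector_mult_diff_distrib[of A 0 u] matrix_vector_mult_diff_rdistrib[of 0 A u]
  by simp_all

text \<open>The norm of a matrix type is the Frobenius norm; this turns the trace terms of
  \<open>Z_norm\<close>, \<open>J_functional\<close> and \<open>L_functional\<close> into squared
  norms.\<close>

lemma trace_mult_transpose:
  fixes A :: "real^'n^'m"
  shows "trace (A ** transpose A) = (norm A)\<^sup>2"
  by (simp add: trace_def matrix_matrix_mult_def transpose_def power2_norm_eq_inner inner_vec_def)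

lemma L2_measurable: "f \<in> L2_space T \<Longrightarrow> f \<in> borel_measurable (lebesgue_on {0..T})"
  by (simp add: L2_space_def)

lemma L2_integrable_power2: "f \<in> L2_space T \<Longrightarrow> integrable (lebesgue_on {0..T}) (\<lambda>t. (norm (f t))\<^sup>2)"
  by (simp add: L2_space_def)

text \<open>A product of norms is at most the sum of their squares. A general bilinear
  \<open>p\<close> serves inner products, scalar multiples and outer products alike.\<close>

lemma L2_bilinear_integrable:
  fixes f :: "real \<Rightarrow> 'a::euclidean_space" and g :: "real \<Rightarrow> 'b::euclidean_space"
    and p :: "'a \<Rightarrow> 'b \<Rightarrow> 'c::euclidean_space"
  assumes "bounded_bilinear p" and f: "f \<in> L2_space T" and g: "g \<in> L2_space T"
  shows "integrable (lebesgue_on {0..T}) (\<lambda>t. p (f t) (g t))"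
proof -
  interpret bounded_bilinear p by fact
  obtain K where K: "0 < K" "\<And>a b. norm (p a b) \<le> norm a * norm b * K"
    using pos_bounded by blast
  note [measurable] = L2_measurable[OF f] L2_measurable[OF g]
  have "(\<lambda>t. p (f t) (g t)) \<in> borel_measurable (lebesgue_on {0..T})"
    by (rule borel_measurable_continuous_Pair[OF L2_measurable[OF f] L2_measurable[OF g]])
      (intro continuous_on continuous_intros)
  moreover have "norm (p (f t) (g t)) \<le> norm (K * ((norm (f t))\<^sup>2 + (norm (g t))\<^sup>2))" for t
  proof -
    have "norm (f t) * norm (g t) \<le> (norm (f t))\<^sup>2 + (norm (g t))\<^sup>2"
      using sum_squares_bound[of "norm (f t)" "norm (g t)"]
        mult_nonneg_nonneg[OF norm_ge_zero[of "f t"] norm_ge_zero[of "g t"]] by linarith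
    then have "norm (f t) * norm (g t) * K \<le> ((norm (f t))\<^sup>2 + (norm (g t))\<^sup>2) * K"
      using K(1) by (intro mult_right_mono) auto
    with K(2)[of "f t" "g t"] have "norm (p (f t) (g t)) \<le> ((norm (f t))\<^sup>2 + (norm (g t))\<^sup>2) * K"
      by (rule order_trans)
    with K(1) show ?thesis by (simp add: mult.commute)
  qed
  moreover have "integrable (lebesgue_on {0..T}) (\<lambda>t. K * ((norm (f t))\<^sup>2 + (norm (g t))\<^sup>2))"
    by (intro integrable_mult_right Bochner_Integration.integrable_add L2_integrable_power2 f g)
  ultimately show ?thesis
    by (blast intro: Bochner_Integration.integrable_bound AE_I2)
qed

lemmas L2_inner_integrable = L2_bilinear_integrable[OF bounded_bilinear_inner]

lemma L2_spaceI:
  assumes "f \<in> borel_measurable (lebesgue_on {0..T})"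
    and "integrable (lebesgue_on {0..T}) (\<lambda>t. f t \<bullet> f t)"
  shows "f \<in> L2_space T"
  using assms by (simp add: L2_space_def power2_norm_eq_inner)

lemma L2_add:
  assumes f: "f \<in> L2_space T" and g: "g \<in> L2_space T"
  shows "(\<lambda>t. f t + g t) \<in> L2_space T"
proof (rule L2_spaceI)
  show "(\<lambda>t. f t + g t) \<in> borel_measurable (lebesgue_on {0..T})"
    using L2_measurable[OF f] L2_measurable[OF g] by measurable
  show "integrable (lebesgue_on {0..T}) (\<lambda>t. (f t + g t) \<bullet> (f t + g t))"
    unfolding inner_add_left inner_add_right
    using f g by (intro Bochner_Integration.integrable_add L2_inner_integrable)
qed

lemma L2_linear:
  fixes f :: "real \<Rightarrow> 'a::euclidean_space" and l :: "'a \<Rightarrow> 'b::euclidean_space"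
  assumes l: "bounded_linear l" and f: "f \<in> L2_space T"
  shows "(\<lambda>t. l (f t)) \<in> L2_space T"
proof (rule L2_spaceI)
  show "(\<lambda>t. l (f t)) \<in> borel_measurable (lebesgue_on {0..T})"
    by (rule measurable_compose[OF L2_measurable[OF f]])
      (intro borel_measurable_continuous_onI bounded_linear.continuous_on[OF l] continuous_on_id)
  have "bounded_bilinear (\<lambda>a b. l a \<bullet> l b)"
    by (intro bounded_bilinear.comp[OF bounded_bilinear_inner] l)
  from L2_bilinear_integrable[OF this f f]
  show "integrable (lebesgue_on {0..T}) (\<lambda>t. l (f t) \<bullet> l (f t))" .
qed

lemma L2_matrix: "f \<in> L2_space T \<Longrightarrow> (\<lambda>t. (A :: real^'n^'m) *v f t) \<in> L2_space T"
  by (rule L2_linear) simp_all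

lemma L2_scaleR: "f \<in> L2_space T \<Longrightarrow> (\<lambda>t. c *\<^sub>R f t) \<in> L2_space T"
  by (rule L2_linear[OF bounded_linear_scaleR_right])

lemma L2_uminus: "f \<in> L2_space T \<Longrightarrow> (\<lambda>t. - f t) \<in> L2_space T"
  using L2_scaleR[of f T "-1"] by simp

lemma L2_diff:
  "f \<in> L2_space T \<Longrightarrow> g \<in> L2_space T \<Longrightarrow> (\<lambda>t. f t - g t) \<in> L2_space T"
  using L2_add[OF _ L2_uminus, of f T g] by simp

lemma L2_continuous:
  fixes f :: "real \<Rightarrow> 'a::euclidean_space"
  assumes "continuous_on {0..T} f"
  shows "f \<in> L2_space T"
proof (rule L2_spaceI)
  show "f \<in> borel_measurable (lebesgue_on {0..T})"
    by (rule continuous_imp_measurable_on_sets_lebesgue[OF assms]) simp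
  have "continuous_on {0..T} (\<lambda>t. f t \<bullet> f t)" by (intro continuous_intros assms)
  then have "(\<lambda>t. f t \<bullet> f t) absolutely_integrable_on {0..T}"
    by (rule absolutely_integrable_continuous_real)
  then show "integrable (lebesgue_on {0..T}) (\<lambda>t. f t \<bullet> f t)"
    by (simp add: set_integrable_def integrable_restrict_space)
qed

lemma L2_const: "(\<lambda>t. c) \<in> L2_space T"
  by (intro L2_continuous continuous_intros)

lemmas L2_closed = L2_add L2_diff L2_uminus L2_scaleR L2_matrix L2_const

text \<open>Product with the constant 1, which is square integrable because the interval is
  bounded.\<close>

lemma L2_integrable:
  assumes "f \<in> L2_space T" shows "integrable (lebesgue_on {0..T}) f"
  using L2_bilinear_integrable[OF bounded_bilinear_scaleR L2_const[of "1::real"] assms] by simp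

lemma L2_absolutely_integrable:
  assumes "f \<in> L2_space T" shows "f absolutely_integrable_on {0..T}"
  using L2_integrable[OF assms] by (simp add: set_integrable_def integrable_restrict_space)

section \<open>The L2 seminorm and the Cauchy-Schwarz inequality\<close>

definition L2_inner :: "real \<Rightarrow> (real \<Rightarrow> 'a::euclidean_space) \<Rightarrow> (real \<Rightarrow> 'a) \<Rightarrow> real" where
  "L2_inner T f g = (LINT t|lebesgue_on {0..T}. f t \<bullet> g t)"

text \<open>Functions equal almost everywhere stay distinct, so this is only a seminorm; equations
  derived from a vanishing norm hold almost everywhere.\<close>

definition L2_norm :: "real \<Rightarrow> (real \<Rightarrow> 'a::euclidean_space) \<Rightarrow> real" where
  "L2_norm T f = sqrt (LINT t|lebesgue_on {0..T}. (norm (f t))\<^sup>2)"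

lemma L2_norm_power2: "(L2_norm T f)\<^sup>2 = (LINT t|lebesgue_on {0..T}. (norm (f t))\<^sup>2)"
  by (simp add: L2_norm_def)

lemma L2_norm_nonneg: "0 \<le> L2_norm T f"
  by (simp add: L2_norm_def)

lemma L2_inner_self: "L2_inner T f f = (L2_norm T f)\<^sup>2"
  by (simp add: L2_norm_power2 L2_inner_def power2_norm_eq_inner)

lemma L2_inner_commute: "L2_inner T f g = L2_inner T g f"
  by (simp add: L2_inner_def inner_commute)

lemma L2_inner_add_left:
  "f \<in> L2_space T \<Longrightarrow> g \<in> L2_space T \<Longrightarrow> h \<in> L2_space T \<Longrightarrow>
    L2_inner T (\<lambda>t. f t + g t) h = L2_inner T f h + L2_inner T g h"
  unfolding L2_inner_def inner_add_left
  by (intro Bochner_Integration.integral_add L2_inner_integrable)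

lemma L2_inner_scaleR_left: "L2_inner T (\<lambda>t. c *\<^sub>R f t) h = c * L2_inner T f h"
  by (simp add: L2_inner_def)

lemma L2_inner_diff_left:
  "f \<in> L2_space T \<Longrightarrow> g \<in> L2_space T \<Longrightarrow> h \<in> L2_space T \<Longrightarrow>
    L2_inner T (\<lambda>t. f t - g t) h = L2_inner T f h - L2_inner T g h"
  unfolding L2_inner_def inner_diff_left
  by (intro Bochner_Integration.integral_diff L2_inner_integrable)

lemma L2_inner_add_right:
  "f \<in> L2_space T \<Longrightarrow> g \<in> L2_space T \<Longrightarrow> h \<in> L2_space T \<Longrightarrow>
    L2_inner T h (\<lambda>t. f t + g t) = L2_inner T h f + L2_inner T h g"
  by (simp add: L2_inner_commute[of T h] L2_inner_add_left)

lemma L2_inner_diff_right: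
  "f \<in> L2_space T \<Longrightarrow> g \<in> L2_space T \<Longrightarrow> h \<in> L2_space T \<Longrightarrow>
    L2_inner T h (\<lambda>t. f t - g t) = L2_inner T h f - L2_inner T h g"
  by (simp add: L2_inner_commute[of T h] L2_inner_diff_left)

lemma L2_inner_scaleR_right: "L2_inner T f (\<lambda>t. c *\<^sub>R h t) = c * L2_inner T f h"
  by (simp add: L2_inner_def)

lemma L2_inner_matrix_left:
  fixes A :: "real^'n^'m"
  shows "L2_inner T (\<lambda>t. A *v f t) h = L2_inner T f (\<lambda>t. transpose A *v h t)"
proof -
  have "(A *v a) \<bullet> b = a \<bullet> (transpose A *v b)" for a b
    by (metis dot_lmul_matrix inner_commute transpose_matrix_vector)
  then show ?thesis by (simp add: L2_inner_def)
qed

lemma L2_inner_matrix_right: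
  fixes A :: "real^'n^'m"
  shows "L2_inner T h (\<lambda>t. A *v f t) = L2_inner T (\<lambda>t. transpose A *v h t) f"
  by (metis L2_inner_commute L2_inner_matrix_left)

lemma L2_inner_zero_right: "L2_inner T f (\<lambda>t. 0) = 0"
  by (simp add: L2_inner_def)

lemma L2_inner_cong_AE:
  assumes "f \<in> L2_space T" "f' \<in> L2_space T" "g \<in> L2_space T" "g' \<in> L2_space T"
    and "AE t in lebesgue_on {0..T}. f t = f' t" and "AE t in lebesgue_on {0..T}. g t = g' t"
  shows "L2_inner T f g = L2_inner T f' g'"
  unfolding L2_inner_def
  using assms(5,6)
  by (intro integral_cong_AE borel_measurable_inner L2_measurable assms(1-4)) auto

lemma L2_norm_cong_AE:
  assumes "f \<in> L2_space T" "f' \<in> L2_space T" "AE t in lebesgue_on {0..T}. f t = f' t"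
  shows "L2_norm T f = L2_norm T f'"
proof -
  have "(L2_norm T f)\<^sup>2 = (L2_norm T f')\<^sup>2"
    unfolding L2_inner_self[symmetric] by (rule L2_inner_cong_AE) (use assms in auto)
  then show ?thesis by (simp add: L2_norm_nonneg)
qed

lemma L2_norm_eq_0_AE:
  assumes "f \<in> L2_space T" "L2_norm T f = 0"
  shows "AE t in lebesgue_on {0..T}. f t = 0"
proof -
  have "(LINT t|lebesgue_on {0..T}. (norm (f t))\<^sup>2) = 0"
    using assms(2) by (simp flip: L2_norm_power2)
  then have "AE t in lebesgue_on {0..T}. (norm (f t))\<^sup>2 = 0"
    using integral_nonneg_eq_0_iff_AE[OF L2_integrable_power2[OF assms(1)]] by simp
  then show ?thesis by simp
qed

text \<open>An affine function that is never negative is constant, a concave quadratic is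
  impossible, and a convex one is evaluated at its vertex. This yields Cauchy-Schwarz and, with
  \<open>a = 0\<close>, vanishing first variations.\<close>

lemma quadratic_nonneg_discriminant:
  fixes a b c :: real
  assumes "\<And>s. 0 \<le> a + s * b + s\<^sup>2 * c"
  shows "b\<^sup>2 \<le> 4 * a * c"
proof (cases "c = 0")
  case True
  have "b = 0"
  proof (rule ccontr)
    assume "b \<noteq> 0"
    \<comment> \<open>At this point \<open>a + s * b\<close> equals -1.\<close>
    then show False using assms[of "(- a - 1) / b"] True by simp
  qed
  with True show ?thesis by simp
next
  case False
  have "c > 0"
  proof (rule ccontr)
    assume "\<not> c > 0"
    with False have c: "c < 0" by simp
    \<comment> \<open>Large enough that \<open>k\<^sup>2 * (- c)\<close> exceeds
      \<open>\<bar>a\<bar> + k * \<bar>b\<bar>\<close>; the last summand makes \<open>k\<close> at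
      least 1.\<close>
    define k where "k = (\<bar>a\<bar> + \<bar>b\<bar> + 1) / (- c) + 1"
    have k: "1 \<le> k" "k * (- c) \<ge> \<bar>a\<bar> + \<bar>b\<bar> + 1"
      using c by (auto simp: k_def field_simps zero_le_divide_iff)
    have "k * (k * (- c)) \<ge> k * (\<bar>a\<bar> + \<bar>b\<bar> + 1)"
      using k by (intro mult_left_mono) auto
    moreover have "k * (\<bar>a\<bar> + 1) \<ge> \<bar>a\<bar> + 1" using k mult_right_mono[of 1 k "\<bar>a\<bar> + 1"] by simp
    moreover have "k * b \<le> k * \<bar>b\<bar>" using k by (intro mult_left_mono) auto
    ultimately show False using assms[of k] by (simp add: power2_eq_square algebra_simps)
  qed
  have "0 \<le> (a + (- b / (2 * c)) * b + (- b / (2 * c))\<^sup>2 * c) * (4 * c)"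
    using assms[of "- b / (2 * c)"] \<open>c > 0\<close> by simp
  also have "\<dots> = 4 * a * c - b\<^sup>2"
    using \<open>c > 0\<close> by (simp add: field_simps power2_eq_square)
  finally show ?thesis by simp
qed

lemma L2_norm_power2_add:
  assumes "f \<in> L2_space T" "g \<in> L2_space T"
  shows "(L2_norm T (\<lambda>t. f t + g t))\<^sup>2 = (L2_norm T f)\<^sup>2 + 2 * L2_inner T f g + (L2_norm T g)\<^sup>2"
  using assms L2_inner_commute[of T f g]
  by (simp flip: L2_inner_self add: L2_inner_add_left L2_inner_add_right L2_add)

lemma L2_norm_scaleR: "L2_norm T (\<lambda>t. c *\<^sub>R f t) = \<bar>c\<bar> * L2_norm T f"
  by (simp add: L2_norm_def power_mult_distrib real_sqrt_mult)

text \<open>The squared norm of \<open>f + s g\<close> is a nonnegative quadratic in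
  \<open>s\<close>. The discriminant also covers \<open>L2_norm T g = 0\<close>, where
  \<open>g\<close> cannot be normalized.\<close>

lemma L2_Cauchy_Schwarz:
  assumes f: "f \<in> L2_space T" and g: "g \<in> L2_space T"
  shows "\<bar>L2_inner T f g\<bar> \<le> L2_norm T f * L2_norm T g"
proof -
  have "(2 * L2_inner T f g)\<^sup>2 \<le> 4 * (L2_norm T f)\<^sup>2 * (L2_norm T g)\<^sup>2"
  proof (rule quadratic_nonneg_discriminant)
    fix s
    have "0 \<le> (L2_norm T (\<lambda>t. f t + s *\<^sub>R g t))\<^sup>2" by simp
    then show "0 \<le> (L2_norm T f)\<^sup>2 + s * (2 * L2_inner T f g) + s\<^sup>2 * (L2_norm T g)\<^sup>2"
      by (subst (asm) L2_norm_power2_add)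
        (use f g in \<open>simp_all add: L2_scaleR L2_inner_scaleR_right L2_norm_scaleR power_mult_distrib mult_ac\<close>)
  qed
  then have "(L2_inner T f g)\<^sup>2 \<le> (L2_norm T f * L2_norm T g)\<^sup>2"
    by (simp add: power_mult_distrib)
  then show ?thesis
    by (metis L2_norm_nonneg abs_le_square_iff abs_of_nonneg mult_nonneg_nonneg)
qed

lemma L2_norm_triangle:
  assumes f: "f \<in> L2_space T" and g: "g \<in> L2_space T"
  shows "L2_norm T (\<lambda>t. f t + g t) \<le> L2_norm T f + L2_norm T g"
proof (rule power2_le_imp_le)
  show "(L2_norm T (\<lambda>t. f t + g t))\<^sup>2 \<le> (L2_norm T f + L2_norm T g)\<^sup>2"
    using L2_Cauchy_Schwarz[OF f g] by (simp add: L2_norm_power2_add[OF f g] power2_sum)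
qed (simp add: L2_norm_nonneg)

lemma L2_norm_minus: "L2_norm T (\<lambda>t. - f t) = L2_norm T f"
  by (simp add: L2_norm_def)

lemma L2_norm_triangle_diff:
  assumes f: "f \<in> L2_space T" and g: "g \<in> L2_space T"
  shows "L2_norm T (\<lambda>t. f t - g t) \<le> L2_norm T f + L2_norm T g"
  using L2_norm_triangle[OF f L2_uminus[OF g]] by (simp add: L2_norm_minus)

lemma L2_norm_mono:
  fixes f :: "real \<Rightarrow> 'a::euclidean_space" and g :: "real \<Rightarrow> 'b::euclidean_space"
  assumes f: "f \<in> L2_space T" and g: "g \<in> L2_space T"
    and "AE t in lebesgue_on {0..T}. norm (f t) \<le> norm (g t)"
  shows "L2_norm T f \<le> L2_norm T g"
  unfolding L2_norm_def
  using assms(3)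
  by (intro real_sqrt_le_mono integral_mono_AE L2_integrable_power2 f g) (auto intro: power_mono)

lemma L2_norm_matrix:
  fixes A :: "real^'n^'m"
  assumes f: "f \<in> L2_space T"
  shows "L2_norm T (\<lambda>t. A *v f t) \<le> norm A * L2_norm T f"
proof -
  have "L2_norm T (\<lambda>t. A *v f t) \<le> L2_norm T (\<lambda>t. norm A *\<^sub>R f t)"
    by (rule L2_norm_mono) (use f in \<open>auto intro: L2_matrix L2_scaleR simp: norm_matrix_vector_mult_le\<close>)
  then show ?thesis by (simp add: L2_norm_scaleR)
qed

lemma L2_norm_const: "0 \<le> T \<Longrightarrow> L2_norm T (\<lambda>t. c) = sqrt T * norm c"
  by (simp add: L2_norm_def real_sqrt_mult measure_restrict_space)

lemma L2_norm_sup_bound: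
  assumes "0 \<le> T" "0 \<le> K" "f \<in> L2_space T" "\<And>t. t \<in> {0..T} \<Longrightarrow> norm (f t) \<le> K"
  shows "L2_norm T f \<le> sqrt T * K"
proof -
  have "L2_norm T f \<le> L2_norm T (\<lambda>t. K)"
    by (rule L2_norm_mono) (use assms in \<open>auto intro: L2_const\<close>)
  with assms show ?thesis by (simp add: L2_norm_const)
qed

text \<open>Cauchy-Schwarz against the constant 1, of norm \<open>sqrt T\<close>.\<close>

lemma L2_norm_integral_bound:
  assumes "0 \<le> T" "f \<in> L2_space T"
  shows "(LINT t|lebesgue_on {0..T}. norm (f t)) \<le> sqrt T * L2_norm T f"
proof -
  have n: "(\<lambda>t. norm (f t)) \<in> L2_space T"
    using assms(2) by (auto simp: L2_space_def intro: borel_measurable_norm)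
  have "L2_inner T (\<lambda>t. norm (f t)) (\<lambda>t. 1) \<le> L2_norm T (\<lambda>t. norm (f t)) * L2_norm T (\<lambda>t. 1::real)"
    using L2_Cauchy_Schwarz[OF n L2_const[of "1::real"]] by linarith
  then show ?thesis
    using assms(1) by (simp add: L2_norm_const L2_inner_def mult.commute) (simp add: L2_norm_def)
qed

section \<open>Absolutely continuous representatives of \<open>H\<^sup>1(0,T)\<close>\<close>

text \<open>Absolute continuity with a square integrable density. For \<open>0 < T\<close> and
  continuous \<open>x\<close> it is equivalent to \<open>is_weak_derivative T x g\<close>; the
  estimates are all made in this integral form.\<close>

definition H1_pair :: "real \<Rightarrow> (real \<Rightarrow> 'a::euclidean_space) \<Rightarrow> (real \<Rightarrow> 'a) \<Rightarrow> bool" where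
  "H1_pair T x g \<longleftrightarrow> g \<in> L2_space T \<and> (\<forall>t\<in>{0..T}. x t = x 0 + integral {0..t} g)"

lemma H1_pair_L2: "H1_pair T x g \<Longrightarrow> g \<in> L2_space T"
  by (simp add: H1_pair_def)

lemma H1_pair_eq: "H1_pair T x g \<Longrightarrow> t \<in> {0..T} \<Longrightarrow> x t = x 0 + integral {0..t} g"
  unfolding H1_pair_def by blast

lemma L2_integrable_on_subinterval:
  assumes "g \<in> L2_space T" "{s..t} \<subseteq> {0..T}" shows "g integrable_on {s..t}"
  using set_lebesgue_integral_eq_integral(1)[OF L2_absolutely_integrable[OF assms(1)]] assms(2)
  by (rule integrable_on_subinterval)

lemma H1_pair_increment:
  assumes "H1_pair T x g" "0 \<le> s" "s \<le> t" "t \<le> T"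
  shows "x t - x s = integral {s..t} g"
proof -
  have *: "integral {0..s} g + integral {s..t} g = integral {0..t} g"
    using assms by (intro Henstock_Kurzweil_Integration.integral_combine
        L2_integrable_on_subinterval[OF H1_pair_L2[OF assms(1)]]) auto
  have "x t - x s = (x 0 + integral {0..t} g) - (x 0 + integral {0..s} g)"
    using assms by (intro arg_cong2[where f = "(-)"] H1_pair_eq[OF assms(1)]) auto
  then have "x t - x s = integral {0..t} g - integral {0..s} g" by (simp only: add_diff_cancel_left)
  with * show ?thesis by (metis add_diff_cancel_left')
qed

lemma H1_pair_continuous:
  assumes "H1_pair T x g"
  shows "continuous_on {0..T} x"
proof -
  have "continuous_on {0..T} (\<lambda>t. x 0 + integral {0..t} g)"
    by (intro continuous_intros indefinite_integral_continuous_1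
        L2_integrable_on_subinterval[OF H1_pair_L2[OF assms]]) auto
  then show ?thesis
    by (rule continuous_on_eq) (rule H1_pair_eq[OF assms, symmetric])
qed

lemma H1_pair_state_L2: "H1_pair T x g \<Longrightarrow> x \<in> L2_space T"
  by (intro L2_continuous H1_pair_continuous)

lemma H1_pairI_increment:
  assumes "g \<in> L2_space T" "\<And>t. t \<in> {0..T} \<Longrightarrow> x t = c + integral {0..t} g"
  shows "H1_pair T x g"
  unfolding H1_pair_def
proof (intro conjI ballI)
  fix t assume t: "t \<in> {0..T}"
  then have "x 0 = c" by (subst assms(2)) auto
  then show "x t = x 0 + integral {0..t} g" by (simp only: assms(2)[OF t])
qed fact

lemma H1_pair_linear:
  assumes "H1_pair T x g" "H1_pair T y h"
  shows "H1_pair T (\<lambda>t. x t + c *\<^sub>R y t) (\<lambda>t. g t + c *\<^sub>R h t)"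
  unfolding H1_pair_def
proof (intro conjI ballI)
  show "(\<lambda>t. g t + c *\<^sub>R h t) \<in> L2_space T"
    using assms by (intro L2_add L2_scaleR) (auto simp: H1_pair_def)
  fix t assume t: "t \<in> {0..T}"
  then have i: "g integrable_on {0..t}" "h integrable_on {0..t}"
    using assms by (auto intro!: L2_integrable_on_subinterval simp: H1_pair_def)
  have "integral {0..t} (\<lambda>t. g t + c *\<^sub>R h t) = integral {0..t} g + c *\<^sub>R integral {0..t} h"
    using i by (simp add: Henstock_Kurzweil_Integration.integral_add integrable_cmul)
  moreover have "x t + c *\<^sub>R y t = (x 0 + integral {0..t} g) + c *\<^sub>R (y 0 + integral {0..t} h)"
    using H1_pair_eq[OF assms(1) t] H1_pair_eq[OF assms(2) t] by (rule arg_cong2)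
  ultimately show "x t + c *\<^sub>R y t = x 0 + c *\<^sub>R y 0 + integral {0..t} (\<lambda>t. g t + c *\<^sub>R h t)"
    by (simp add: algebra_simps)
qed

lemma H1_pair_diff:
  assumes "H1_pair T x g" "H1_pair T y h"
  shows "H1_pair T (\<lambda>t. x t - y t) (\<lambda>t. g t - h t)"
  using H1_pair_linear[OF assms, of "-1"] by simp

lemma H1_pair_const: "H1_pair T (\<lambda>t. c) (\<lambda>t. 0)"
  by (simp add: H1_pair_def L2_const)

section \<open>Integration by parts for absolutely continuous functions\<close>

text \<open>Cut \<open>{0..T}\<close> into equal pieces shorter than \<open>d\<close>, apply the
  local bound on each and telescope.\<close>

lemma increment_bound_from_local:
  fixes F :: "real \<Rightarrow> 'a::real_normed_vector" and H :: "real \<Rightarrow> real"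
  assumes "0 < T" "0 < d"
    and loc: "\<And>s t. 0 \<le> s \<Longrightarrow> s \<le> t \<Longrightarrow> t \<le> T \<Longrightarrow> t - s < d \<Longrightarrow> norm (F t - F s) \<le> H t - H s"
  shows "norm (F T - F 0) \<le> H T - H 0"
proof -
  obtain n :: nat where n: "T / d < real n" using reals_Archimedean2 by blast
  have n0: "real n > 0" using n assms(1,2) by (meson divide_pos_pos less_trans)
  define u where "u i = T * real i / real n" for i :: nat
  have u: "0 \<le> u i" "u i \<le> u (Suc i)" "u (Suc i) - u i < d" for i
    using assms(1,2) n n0 by (auto simp: u_def field_simps)
  have uT: "u i \<le> T" if "i \<le> n" for i
    using that assms(1) n0 by (auto simp: u_def field_simps)
  have "norm (F (u i) - F 0) \<le> H (u i) - H 0" if "i \<le> n" for i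
    using that
  proof (induction i)
    case 0 then show ?case by (simp add: u_def)
  next
    case (Suc i)
    have "norm (F (u (Suc i)) - F 0) \<le> norm (F (u (Suc i)) - F (u i)) + norm (F (u i) - F 0)"
      using norm_triangle_ineq[of "F (u (Suc i)) - F (u i)" "F (u i) - F 0"] by simp
    also have "\<dots> \<le> (H (u (Suc i)) - H (u i)) + (H (u i) - H 0)"
      using Suc.prems
      by (intro add_mono loc[OF u(1) u(2) uT[OF Suc.prems] u(3)] Suc.IH) simp
    finally show ?case by simp
  qed
  from this[of n] show ?thesis using n0 by (simp add: u_def)
qed

text \<open>The defect in the product rule over a short interval \<open>{s..t}\<close> is
  \<open>\<integral> p (g \<tau>) (y t - y \<tau>) + p (x s - x \<tau>) (h \<tau>)\<close>, which uniform continuity of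
  \<open>x\<close> and \<open>y\<close> makes small relative to \<open>\<integral> norm g + norm h\<close>; hence the defects
  over a fine partition sum up to zero.\<close>

lemma H1_pair_integration_by_parts:
  fixes p :: "'a::euclidean_space \<Rightarrow> 'b::euclidean_space \<Rightarrow> 'c::euclidean_space"
  assumes "0 < T" and bil: "bounded_bilinear p" and x: "H1_pair T x g" and y: "H1_pair T y h"
  shows "(LINT t|lebesgue_on {0..T}. p (g t) (y t)) + (LINT t|lebesgue_on {0..T}. p (x t) (h t))
    = p (x T) (y T) - p (x 0) (y 0)"
proof -
  interpret bounded_bilinear p by fact
  obtain K where K: "0 < K" "\<And>a b. norm (p a b) \<le> norm a * norm b * K"
    using pos_bounded by blast
  note g = H1_pair_L2[OF x] and h = H1_pair_L2[OF y]
  note xL = H1_pair_state_L2[OF x] and yL = H1_pair_state_L2[OF y]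
  define f where "f = (\<lambda>t. p (g t) (y t) + p (x t) (h t))"
  have int_p: "(\<lambda>t. p (a t) (b t)) integrable_on S"
    if "a \<in> L2_space T" "b \<in> L2_space T" "S \<subseteq> {0..T}" "S = {s..t}" for a b S s t
    using integrable_on_lebesgue_on[OF L2_bilinear_integrable[OF bil that(1,2)]] that(3,4)
    by (auto intro: integrable_on_subinterval)
  have int_n: "(\<lambda>t. norm (a t)) integrable_on {s..t}"
    if "a \<in> L2_space T" "{s..t} \<subseteq> {0..T}" for a :: "real \<Rightarrow> 'd::euclidean_space" and s t
  proof -
    have "(\<lambda>t. norm (a t)) integrable_on {0..T}"
      by (intro integrable_on_lebesgue_on integrable_norm L2_integrable that) simp
    then show ?thesis using that(2) by (rule integrable_on_subinterval)
  qed
  define F where "F t = p (x t) (y t) - integral {0..t} f" for t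
  define N where "N t = integral {0..t} (\<lambda>t. norm (g t) + norm (h t))" for t
  have int_f: "f integrable_on {s..t}" if "{s..t} \<subseteq> {0..T}" for s t
    unfolding f_def using that by (intro integrable_add int_p[OF _ _ _ refl] g h xL yL)
  have int_N: "(\<lambda>t. norm (g t) + norm (h t)) integrable_on {s..t}" if "{s..t} \<subseteq> {0..T}" for s t
    using that by (intro integrable_add int_n g h)
  have "norm (F T - F 0) \<le> 0 + e" if "e > 0" for e
  proof -
    \<comment> \<open>Chosen so that \<open>K * e' * (N T + 1) = e\<close>; the summand 1 avoids
      division by zero when \<open>g\<close> and \<open>h\<close> vanish.\<close>
    define e' where "e' = e / (K * (N T + 1))"
    have NT: "0 \<le> N T" unfolding N_def by (intro integral_nonneg int_N) auto
    have e': "e' > 0" using that NT K(1) by (simp add: e'_def)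
    have "uniformly_continuous_on {0..T} x" "uniformly_continuous_on {0..T} y"
      using H1_pair_continuous[OF x] H1_pair_continuous[OF y]
      by (auto intro: compact_uniformly_continuous)
    then obtain d1 d2 where d: "0 < d1" "0 < d2"
      "\<And>s t. s \<in> {0..T} \<Longrightarrow> t \<in> {0..T} \<Longrightarrow> dist t s < d1 \<Longrightarrow> dist (x t) (x s) < e'"
      "\<And>s t. s \<in> {0..T} \<Longrightarrow> t \<in> {0..T} \<Longrightarrow> dist t s < d2 \<Longrightarrow> dist (y t) (y s) < e'"
      using e' unfolding uniformly_continuous_on_def by metis
    have "norm (F T - F 0) \<le> K * e' * N T - K * e' * N 0"
    proof (rule increment_bound_from_local[of T "min d1 d2"])
      fix s t :: real assume st: "0 \<le> s" "s \<le> t" "t \<le> T" "t - s < min d1 d2"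
      have sub: "{s..t} \<subseteq> {0..T}" using st by auto
      have c: "integral {0..t} u - integral {0..s} u = integral {s..t} u"
        if "u integrable_on {0..t}" for u :: "real \<Rightarrow> 'd::euclidean_space"
        using Henstock_Kurzweil_Integration.integral_combine[OF st(1,2) that] by (simp add: algebra_simps)
      \<comment> \<open>Freezing \<open>y\<close> at the right end and \<open>x\<close> at the left
        end leaves no product of increments.\<close>
      have "p (x t) (y t) - p (x s) (y s) = p (x t - x s) (y t) + p (x s) (y t - y s)"
        by (simp add: diff_left diff_right)
      also have "\<dots> = integral {s..t} (\<lambda>\<tau>. p (g \<tau>) (y t)) + integral {s..t} (\<lambda>\<tau>. p (x s) (h \<tau>))"
        using integral_linear[OF L2_integrable_on_subinterval[OF g sub] bounded_linear_left[of "y t"]]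
          integral_linear[OF L2_integrable_on_subinterval[OF h sub] bounded_linear_right[of "x s"]]
        by (simp add: o_def H1_pair_increment[OF x st(1-3)] H1_pair_increment[OF y st(1-3)])
      finally have "F t - F s = integral {s..t} (\<lambda>\<tau>. p (g \<tau>) (y t)) + integral {s..t} (\<lambda>\<tau>. p (x s) (h \<tau>))
          - integral {s..t} f"
        using c[OF int_f] st by (simp add: F_def algebra_simps)
      also have "\<dots> = integral {s..t} (\<lambda>\<tau>. p (g \<tau>) (y t) + p (x s) (h \<tau>) - f \<tau>)"
        using int_p[OF g L2_const sub refl, of "y t"] int_p[OF L2_const h sub refl, of "x s"] int_f[OF sub]
        by (simp add: Henstock_Kurzweil_Integration.integral_add
            Henstock_Kurzweil_Integration.integral_diff integrable_add)
      also have "norm \<dots> \<le> integral {s..t} (\<lambda>\<tau>. K * e' * (norm (g \<tau>) + norm (h \<tau>)))"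
      proof (rule integral_norm_bound_integral)
        show "(\<lambda>\<tau>. p (g \<tau>) (y t) + p (x s) (h \<tau>) - f \<tau>) integrable_on {s..t}"
          using int_p[OF g L2_const sub refl, of "y t"] int_p[OF L2_const h sub refl, of "x s"] int_f[OF sub]
          by (intro integrable_add integrable_diff)
        show "(\<lambda>\<tau>. K * e' * (norm (g \<tau>) + norm (h \<tau>))) integrable_on {s..t}"
          using integrable_on_cmult_left[OF int_N[OF sub], of "K * e'"] by simp
        fix \<tau> assume \<tau>: "\<tau> \<in> {s..t}"
        have "dist (x s) (x \<tau>) < e'" "dist (y t) (y \<tau>) < e'"
          using st \<tau> by (auto intro!: d simp: dist_real_def)
        then have "norm (p (g \<tau>) (y t - y \<tau>)) \<le> norm (g \<tau>) * e' * K"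
            "norm (p (x s - x \<tau>) (h \<tau>)) \<le> e' * norm (h \<tau>) * K"
          using K(1) unfolding dist_norm
          by (auto intro!: order_trans[OF K(2)] mult_right_mono mult_left_mono)
        moreover have "p (g \<tau>) (y t) + p (x s) (h \<tau>) - f \<tau> = p (g \<tau>) (y t - y \<tau>) + p (x s - x \<tau>) (h \<tau>)"
          by (simp add: f_def diff_left diff_right)
        ultimately show "norm (p (g \<tau>) (y t) + p (x s) (h \<tau>) - f \<tau>) \<le> K * e' * (norm (g \<tau>) + norm (h \<tau>))"
          using norm_triangle_ineq[of "p (g \<tau>) (y t - y \<tau>)" "p (x s - x \<tau>) (h \<tau>)"]
          by (simp add: algebra_simps)
      qed
      also have "\<dots> = K * e' * (N t - N s)"
        using c[OF int_N] st by (simp add: N_def)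
      finally show "norm (F t - F s) \<le> K * e' * N t - K * e' * N s" by (simp add: algebra_simps)
    qed (use \<open>0 < T\<close> d in auto)
    also have "\<dots> = K * e' * N T" by (simp add: N_def)
    also have "\<dots> \<le> K * e' * (N T + 1)" using e' K(1) by (intro mult_left_mono) auto
    also have "\<dots> = e" using K(1) NT by (simp add: e'_def)
    finally show ?thesis by simp
  qed
  then have "norm (F T - F 0) \<le> 0" by (rule field_le_epsilon)
  then have "integral {0..T} f = p (x T) (y T) - p (x 0) (y 0)"
    by (simp add: F_def algebra_simps)
  moreover have "integral {0..T} f = (LINT t|lebesgue_on {0..T}. f t)"
    unfolding f_def
    by (intro lebesgue_integral_eq_integral[symmetric] Bochner_Integration.integrable_add
        L2_bilinear_integrable[OF bil] g h xL yL) simp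
  ultimately show ?thesis
    unfolding f_def using L2_bilinear_integrable[OF bil g yL] L2_bilinear_integrable[OF bil xL h] by simp
qed

section \<open>Weak derivatives and absolute continuity\<close>

lemma C1_has_deriv:
  fixes \<phi> :: "real \<Rightarrow> real"
  assumes "\<phi> C1_differentiable_on UNIV"
  shows "(\<phi> has_vector_derivative deriv \<phi> t) (at t)" "continuous_on UNIV (deriv \<phi>)"
proof -
  obtain D where D: "\<And>t. (\<phi> has_vector_derivative D t) (at t)" "continuous_on UNIV D"
    using assms by (auto simp: C1_differentiable_on_def)
  then have "deriv \<phi> = D"
    by (auto intro!: DERIV_imp_deriv simp: has_real_derivative_iff_has_vector_derivative)
  with D show "(\<phi> has_vector_derivative deriv \<phi> t) (at t)" "continuous_on UNIV (deriv \<phi>)" by auto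
qed

lemma H1_pair_C1:
  fixes \<phi> :: "real \<Rightarrow> real"
  assumes "\<phi> C1_differentiable_on UNIV"
  shows "H1_pair T \<phi> (deriv \<phi>)"
  unfolding H1_pair_def
proof (intro conjI ballI)
  show "deriv \<phi> \<in> L2_space T"
    using C1_has_deriv(2)[OF assms] continuous_on_subset by (blast intro: L2_continuous)
  fix t assume "t \<in> {0..T}"
  then have "(deriv \<phi> has_integral \<phi> t - \<phi> 0) {0..t}"
    using has_vector_derivative_at_within[OF C1_has_deriv(1)[OF assms]]
    by (intro fundamental_theorem_of_calculus) auto
  then have "integral {0..t} (deriv \<phi>) = \<phi> t - \<phi> 0" by (rule integral_unique)
  then show "\<phi> t = \<phi> 0 + integral {0..t} (deriv \<phi>)" by linarith
qed

lemma test_function_boundary: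
  assumes "\<phi> \<in> test_functions T" shows "\<phi> 0 = 0" "\<phi> T = 0"
proof -
  obtain a b where "0 < a" "b < T" "\<And>t. t \<notin> {a..b} \<Longrightarrow> \<phi> t = 0"
    using assms unfolding test_functions_def by blast
  then show "\<phi> 0 = 0" "\<phi> T = 0" by (metis atLeastAtMost_iff not_le)+
qed

text \<open>Integration by parts against a test function, whose boundary values vanish.\<close>

lemma H1_pair_imp_weak_derivative:
  assumes "0 < T" "H1_pair T x g"
  shows "is_weak_derivative T x g"
  unfolding is_weak_derivative_def
proof (intro conjI ballI)
  show "g \<in> L2_space T" by (rule H1_pair_L2) fact
  fix \<phi> assume \<phi>: "\<phi> \<in> test_functions T"
  then have "H1_pair T \<phi> (deriv \<phi>)" by (auto intro: H1_pair_C1 simp: test_functions_def)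
  from H1_pair_integration_by_parts[OF assms(1) bounded_bilinear_scaleR this assms(2)]
  show "(LINT t|lebesgue_on {0..T}. deriv \<phi> t *\<^sub>R x t) = - (LINT t|lebesgue_on {0..T}. \<phi> t *\<^sub>R g t)"
    by (simp add: test_function_boundary[OF \<phi>] eq_neg_iff_add_eq_0)
qed

text \<open>At the kink the difference quotient is at most the increment in modulus. Truncated
  squares are the C1 pieces from which the compactly supported test functions are assembled.\<close>

lemma has_real_derivative_max_0_square:
  "((\<lambda>u::real. (max 0 u)\<^sup>2) has_real_derivative 2 * max 0 u) (at u)"
proof -
  consider "u > 0" | "u < 0" | "u = 0" by linarith
  then show ?thesis
  proof cases
    case 1
    have "((\<lambda>u. u\<^sup>2) has_real_derivative 2 * max 0 u) (at u)"
      using 1 by (auto intro!: derivative_eq_intros)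
    then show ?thesis
      by (rule has_field_derivative_transform_within_open[of _ _ _ "{0<..}"]) (use 1 in auto)
  next
    case 2
    have "((\<lambda>u. 0) has_real_derivative 2 * max 0 u) (at u)"
      using 2 by (auto intro!: derivative_eq_intros)
    then show ?thesis
      by (rule has_field_derivative_transform_within_open[of _ _ _ "{..<0}"]) (use 2 in auto)
  next
    case 3
    have "((\<lambda>h::real. (max 0 h)\<^sup>2 / h) \<longlongrightarrow> 0) (at 0)"
    proof (rule Lim_null_comparison)
      show "\<forall>\<^sub>F h in at 0. norm ((max 0 h)\<^sup>2 / h) \<le> \<bar>h\<bar>"
        by (auto simp: max_def power2_eq_square eventually_at_filter)
      show "((\<lambda>h::real. \<bar>h\<bar>) \<longlongrightarrow> 0) (at 0)"
        by (auto intro!: tendsto_eq_intros)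
    qed
    then show ?thesis using 3 by (simp add: DERIV_def)
  qed
qed

text \<open>A \<open>C\<^sup>1\<close> transition from \<open>0\<close> (left of \<open>- e\<close>) to \<open>1\<close> (right of \<open>e\<close>) and its derivative.\<close>

definition smooth_step :: "real \<Rightarrow> real \<Rightarrow> real" where
  "smooth_step e u = ((max 0 (u + e))\<^sup>2 - 2 * (max 0 u)\<^sup>2 + (max 0 (u - e))\<^sup>2) / (2 * e\<^sup>2)"

definition tent :: "real \<Rightarrow> real \<Rightarrow> real" where
  "tent e u = (max 0 (u + e) - 2 * max 0 u + max 0 (u - e)) / e\<^sup>2"

lemma smooth_step_derivative:
  assumes "e > 0"
  shows "((\<lambda>u. smooth_step e (u - s)) has_real_derivative tent e (u - s)) (at u)"
proof -
  have d: "((\<lambda>u. (max 0 (u - c))\<^sup>2) has_real_derivative 2 * max 0 (u - c)) (at u)" for c :: real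
  proof -
    have "((\<lambda>u. u - c) has_real_derivative 1) (at u)" by (auto intro!: derivative_eq_intros)
    from DERIV_chain2[OF has_real_derivative_max_0_square this] show ?thesis by simp
  qed
  have "((\<lambda>u. ((max 0 (u - (s - e)))\<^sup>2 - 2 * (max 0 (u - s))\<^sup>2 + (max 0 (u - (s + e)))\<^sup>2) / (2 * e\<^sup>2))
      has_real_derivative (2 * max 0 (u - (s - e)) - 2 * (2 * max 0 (u - s)) + 2 * max 0 (u - (s + e))) / (2 * e\<^sup>2)) (at u)"
    by (intro DERIV_cdivide DERIV_add DERIV_diff DERIV_cmult d)
  moreover have "(2 * max 0 (u - (s - e)) - 2 * (2 * max 0 (u - s)) + 2 * max 0 (u - (s + e))) / (2 * e\<^sup>2) = tent e (u - s)"
    using assms by (simp add: tent_def field_simps)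
  ultimately show ?thesis by (simp add: smooth_step_def algebra_simps)
qed

lemma smooth_step_left: "e > 0 \<Longrightarrow> u \<le> - e \<Longrightarrow> smooth_step e u = 0"
  by (simp add: smooth_step_def)

lemma smooth_step_right: "e > 0 \<Longrightarrow> u \<ge> e \<Longrightarrow> smooth_step e u = 1"
  by (simp add: smooth_step_def power2_eq_square field_simps)

lemma tent_nonneg: "0 \<le> e \<Longrightarrow> 0 \<le> tent e u"
  by (simp add: tent_def max_def)

lemma tent_support: "0 < e \<Longrightarrow> e \<le> \<bar>u\<bar> \<Longrightarrow> tent e u = 0"
  by (cases "0 \<le> u") (simp_all add: tent_def)

lemma continuous_tent: "continuous_on S (\<lambda>u. tent e (u - s))"
  unfolding tent_def
  \<comment> \<open>For \<open>e = 0\<close> division by zero makes \<open>tent\<close> constantly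
    0.\<close>
  by (cases "e = 0") (auto intro!: continuous_intros)

text \<open>The shifted tent is nonnegative, vanishes at distance at least \<open>e\<close> from
  \<open>s\<close> and has total mass 1, being the derivative of a step from 0 to 1. The integral is
  thus a weighted average of values of \<open>X\<close> near \<open>s\<close>.\<close>

lemma tent_average:
  fixes X :: "real \<Rightarrow> 'a::euclidean_space"
  assumes "0 < e" "e \<le> s" "s + e \<le> T" and X: "continuous_on {0..T} X"
    and close: "\<And>u. u \<in> {0..T} \<Longrightarrow> \<bar>u - s\<bar> < e \<Longrightarrow> norm (X u - X s) \<le> \<eta>"
  shows "norm ((LINT u|lebesgue_on {0..T}. tent e (u - s) *\<^sub>R X u) - X s) \<le> \<eta>"
proof -
  let ?M = "lebesgue_on {0..T}"
  have t: "(\<lambda>u. tent e (u - s)) \<in> L2_space T" by (intro L2_continuous continuous_tent)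
  note XL = L2_continuous[OF X]
  have "((\<lambda>u. tent e (u - s)) has_integral smooth_step e (T - s) - smooth_step e (0 - s)) {0..T}"
    using assms has_vector_derivative_at_within[OF smooth_step_derivative[OF assms(1),
        unfolded has_real_derivative_iff_has_vector_derivative]]
    by (intro fundamental_theorem_of_calculus) auto
  then have "(LINT u|?M. tent e (u - s)) = 1"
    using assms by (simp add: lebesgue_integral_eq_integral[OF L2_integrable[OF t]] integral_unique
        smooth_step_left smooth_step_right)
  then have one: "(LINT u|?M. tent e (u - s) *\<^sub>R c) = c" for c :: "'b::euclidean_space"
    using integral_scaleR_left[OF L2_integrable[OF t], of c] by simp
  have i: "integrable ?M (\<lambda>u. tent e (u - s) *\<^sub>R Y u)" if "Y \<in> L2_space T" for Y :: "real \<Rightarrow> 'c::euclidean_space"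
    by (rule L2_bilinear_integrable[OF bounded_bilinear_scaleR t that])
  have "(LINT u|?M. tent e (u - s) *\<^sub>R X u) - X s = (LINT u|?M. tent e (u - s) *\<^sub>R X u) - (LINT u|?M. tent e (u - s) *\<^sub>R X s)"
    by (simp only: one)
  also have "\<dots> = (LINT u|?M. tent e (u - s) *\<^sub>R (X u - X s))"
    unfolding scaleR_diff_right
    by (rule Bochner_Integration.integral_diff[symmetric]) (intro i XL L2_const)+
  also have "norm \<dots> \<le> (LINT u|?M. tent e (u - s) *\<^sub>R \<eta>)"
  proof (rule Bochner_Integration.integral_norm_bound_integral)
    show "integrable ?M (\<lambda>u. tent e (u - s) *\<^sub>R (X u - X s))" "integrable ?M (\<lambda>u. tent e (u - s) *\<^sub>R \<eta>)"
      by (intro i L2_diff XL L2_const)+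
    fix u assume "u \<in> space ?M"
    then show "norm (tent e (u - s) *\<^sub>R (X u - X s)) \<le> tent e (u - s) *\<^sub>R \<eta>"
      using close[of u] tent_support[OF assms(1), of "u - s"] tent_nonneg[of e "u - s"] assms(1)
      by (cases "\<bar>u - s\<bar> < e") (auto intro!: mult_left_mono)
  qed
  also have "\<dots> = \<eta>" by (rule one)
  finally show ?thesis .
qed

text \<open>The function rises from 0 to 1 near \<open>s\<close> and falls back to 0 near
  \<open>t\<close>, hence is supported in \<open>{s - e..t + e}\<close>; its derivative is the
  difference of two averaging kernels.\<close>

lemma test_function_steps:
  assumes "0 < e" "e < s" "s < t" "t + e < T"
  defines "\<phi> \<equiv> \<lambda>u. smooth_step e (u - s) - smooth_step e (u - t)"
  shows "\<phi> \<in> test_functions T" "deriv \<phi> u = tent e (u - s) - tent e (u - t)"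
proof -
  have D: "(\<phi> has_real_derivative tent e (u - s) - tent e (u - t)) (at u)" for u
    unfolding \<phi>_def by (intro DERIV_diff smooth_step_derivative assms)
  then show "deriv \<phi> u = tent e (u - s) - tent e (u - t)" by (rule DERIV_imp_deriv)
  have "\<phi> C1_differentiable_on UNIV"
    unfolding C1_differentiable_on_def
    using D by (intro exI[of _ "\<lambda>u. tent e (u - s) - tent e (u - t)"])
      (auto intro!: continuous_intros continuous_tent simp: has_real_derivative_iff_has_vector_derivative)
  moreover have "\<phi> u = 0" if "u \<notin> {s - e..t + e}" for u
  proof -
    from that have "u < s - e \<or> u > t + e" by auto
    with assms(1-4) show ?thesis by (auto simp: \<phi>_def smooth_step_left smooth_step_right)
  qed
  moreover have "0 < s - e" "t + e < T" using assms by auto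
  ultimately show "\<phi> \<in> test_functions T" unfolding test_functions_def by blast
qed

text \<open>Testing with the difference of two smoothed steps compares averages of \<open>X\<close> near \<open>s\<close> and \<open>t\<close>.\<close>

lemma weak_derivative_zero_imp_eq:
  fixes X :: "real \<Rightarrow> 'a::euclidean_space"
  assumes X: "continuous_on {0..T} X"
    and weak: "\<And>\<phi>. \<phi> \<in> test_functions T \<Longrightarrow> (LINT u|lebesgue_on {0..T}. deriv \<phi> u *\<^sub>R X u) = 0"
    and st: "0 < s" "s < t" "t < T"
  shows "X s = X t"
proof -
  let ?M = "lebesgue_on {0..T}"
  have "norm (X s - X t) \<le> 0 + \<eta>" if "\<eta> > 0" for \<eta>
  proof -
    have "\<eta> / 2 > 0" using that by simp
    moreover have "s \<in> {0..T}" "t \<in> {0..T}" using st by auto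
    ultimately obtain d1 d2 where d: "0 < d1" "0 < d2"
      "\<And>u. u \<in> {0..T} \<Longrightarrow> dist u s < d1 \<Longrightarrow> dist (X u) (X s) < \<eta> / 2"
      "\<And>u. u \<in> {0..T} \<Longrightarrow> dist u t < d2 \<Longrightarrow> dist (X u) (X t) < \<eta> / 2"
      using X unfolding continuous_on_iff by metis
    \<comment> \<open>Halving makes the upper bounds strict, so that \<open>{s - e..t + e}\<close>
      lies inside the open interval.\<close>
    define e where "e = min (min d1 d2) (min s (T - t)) / 2"
    define e0 where "e0 = min (min d1 d2) (min s (T - t))"
    have "0 < e0" "e0 \<le> s" "t + e0 \<le> T" "e0 \<le> d1" "e0 \<le> d2"
      using d(1,2) st by (auto simp: e0_def)
    then have e: "0 < e" "e < s" "t + e < T" "e < d1" "e < d2"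
      by (auto simp: e_def simp flip: e0_def)
    define \<phi> where "\<phi> = (\<lambda>u. smooth_step e (u - s) - smooth_step e (u - t))"
    have \<phi>: "\<phi> \<in> test_functions T" "deriv \<phi> u = tent e (u - s) - tent e (u - t)" for u
      unfolding \<phi>_def using test_function_steps[OF e(1,2) st(2) e(3)] by auto
    define a where "a = (LINT u|?M. tent e (u - s) *\<^sub>R X u)"
    define b where "b = (LINT u|?M. tent e (u - t) *\<^sub>R X u)"
    have i: "integrable ?M (\<lambda>u. tent e (u - c) *\<^sub>R X u)" for c
      by (intro L2_bilinear_integrable[OF bounded_bilinear_scaleR] L2_continuous continuous_tent X)
    have "a - b = 0"
      using weak[OF \<phi>(1)] by (simp add: \<phi>(2) a_def b_def scaleR_diff_left Bochner_Integration.integral_diff[OF i i])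
    moreover have "norm (a - X s) \<le> \<eta> / 2"
      unfolding a_def
    proof (rule tent_average[OF e(1) _ _ X])
      fix u assume u: "u \<in> {0..T}" "\<bar>u - s\<bar> < e"
      then have "dist u s < d1" using e by (simp add: dist_real_def)
      from d(3)[OF u(1) this] show "norm (X u - X s) \<le> \<eta> / 2" by (simp add: dist_norm)
    qed (use e st in auto)
    moreover have "norm (b - X t) \<le> \<eta> / 2"
      unfolding b_def
    proof (rule tent_average[OF e(1) _ _ X])
      fix u assume u: "u \<in> {0..T}" "\<bar>u - t\<bar> < e"
      then have "dist u t < d2" using e by (simp add: dist_real_def)
      from d(4)[OF u(1) this] show "norm (X u - X t) \<le> \<eta> / 2" by (simp add: dist_norm)
    qed (use e st in auto)
    ultimately show ?thesis
      using norm_triangle_ineq4[of "b - X t" "a - X s"] by simp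
  qed
  then have "norm (X s - X t) \<le> 0" by (rule field_le_epsilon)
  then show ?thesis by simp
qed

text \<open>The du Bois-Reymond argument: \<open>x\<close> minus the primitive of \<open>g\<close>
  has weak derivative zero, so it is constant on the open interval, and continuity carries the
  constant to the end points.\<close>

lemma weak_derivative_imp_H1_pair:
  fixes x :: "real \<Rightarrow> 'a::euclidean_space"
  assumes "0 < T" and x: "continuous_on {0..T} x" and w: "is_weak_derivative T x g"
  shows "H1_pair T x g"
proof -
  let ?M = "lebesgue_on {0..T}"
  define y where "y t = integral {0..t} g" for t
  have g: "g \<in> L2_space T" using w by (simp add: is_weak_derivative_def)
  have y: "H1_pair T y g"
    by (rule H1_pairI_increment[where c = 0]) (auto simp: y_def g)
  define X where "X t = x t - y t" for t
  have Xc: "continuous_on {0..T} X"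
    unfolding X_def by (intro continuous_intros x H1_pair_continuous[OF y])
  have weak: "(LINT u|?M. deriv \<phi> u *\<^sub>R X u) = 0" if \<phi>: "\<phi> \<in> test_functions T" for \<phi>
  proof -
    have "deriv \<phi> \<in> L2_space T"
      using \<phi> by (intro H1_pair_L2[OF H1_pair_C1]) (simp add: test_functions_def)
    then have i: "integrable ?M (\<lambda>u. deriv \<phi> u *\<^sub>R z u)" if "continuous_on {0..T} z" for z :: "real \<Rightarrow> 'a"
      by (rule L2_bilinear_integrable[OF bounded_bilinear_scaleR _ L2_continuous[OF that]])
    have "(LINT u|?M. deriv \<phi> u *\<^sub>R x u) = (LINT u|?M. deriv \<phi> u *\<^sub>R y u)"
      using w H1_pair_imp_weak_derivative[OF assms(1) y] \<phi> by (simp add: is_weak_derivative_def)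
    then show ?thesis
      unfolding X_def scaleR_diff_right
      by (simp add: Bochner_Integration.integral_diff i x H1_pair_continuous[OF y])
  qed
  have const: "X t = X (T / 2)" if "t \<in> {0<..<T}" for t
  proof (cases t "T / 2" rule: linorder_cases)
    case less
    show ?thesis by (rule weak_derivative_zero_imp_eq[OF Xc weak]) (use that less assms(1) in auto)
  next
    case greater
    show ?thesis
      by (rule weak_derivative_zero_imp_eq[OF Xc weak, symmetric]) (use that greater assms(1) in auto)
  next
    case equal
    then show ?thesis by (rule arg_cong)
  qed
  have "X t = X (T / 2)" if "t \<in> {0..T}" for t
  proof (rule continuous_constant_on_closure[OF _ const])
    have "closure {0<..<T} = {0..T}" using assms(1) by simp
    with Xc that show "continuous_on (closure {0<..<T}) X" "t \<in> closure {0<..<T}" by simp_all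
  qed
  then have "x t = X (T / 2) + integral {0..t} g" if "t \<in> {0..T}" for t
    using that unfolding X_def y_def by (metis diff_add_cancel)
  with g show ?thesis by (rule H1_pairI_increment)
qed

section \<open>Uniqueness of the derivative\<close>

text \<open>The sets over which \<open>f\<close> integrates to zero form a Dynkin system containing the rays.\<close>

lemma AE_zero_if_integral_atLeast_zero:
  fixes f :: "real \<Rightarrow> 'a::euclidean_space"
  assumes f: "integrable lebesgue f" and rays: "\<And>a. (LINT x:{a..}|lebesgue. f x) = 0"
  shows "AE x in lebesgue. f x = 0"
proof (rule sigma_finite_measure.density_zero[OF _ f])
  show "sigma_finite_measure (lebesgue :: real measure)"
  proof (unfold_locales, intro exI conjI ballI)
    have "\<exists>n. x \<in> {- real n..real n}" for x
    proof -
      obtain n :: nat where "\<bar>x\<bar> < real n" using reals_Archimedean2 by blast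
      then have "x \<in> {- real n..real n}" by auto
      then show ?thesis by (rule exI)
    qed
    then show "(\<Union>n. {- real n..real n}) = space lebesgue" by auto
  qed auto
next
  have si: "set_integrable lebesgue A f" if "A \<in> sets lebesgue" for A
    unfolding set_integrable_def by (rule integrable_mult_indicator[OF that f])
  have sb: "set_borel_measurable lebesgue A f" if "A \<in> sets lebesgue" for A
    using si[OF that] unfolding set_borel_measurable_def set_integrable_def by (rule borel_measurable_integrable)
  have gen: "sets borel = sigma_sets UNIV (range (\<lambda>a::real. {a..}))"
    by (simp add: borel_Ici)
  \<comment> \<open>Complements are taken in the whole line, whose integral is the limit over the
    increasing rays \<open>{- real n..}\<close>.\<close>
  have total: "(LINT x:UNIV|lebesgue. f x) = 0"
  proof -
    have "((\<lambda>n. LINT x:{- real n..}|lebesgue. f x) \<longlongrightarrow> (LINT x:(\<Union>n. {- real n..})|lebesgue. f x)) sequentially"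
      by (rule set_integral_cont_up) (auto simp: incseq_def intro!: si)
    moreover have "(\<Union>n. {- real n..}) = UNIV"
      using reals_Archimedean2 by (force simp: minus_le_iff intro: less_imp_le)
    ultimately show ?thesis by (simp add: rays LIMSEQ_const_iff)
  qed
  have borel: "(LINT x:B|lebesgue. f x) = 0" if "B \<in> sigma_sets UNIV (range (\<lambda>a::real. {a..}))" for B
  proof (rule sigma_sets_induct_disjoint[OF _ _ that])
    fix A assume compl: "A \<in> sigma_sets UNIV (range (\<lambda>a::real. {a..}))" "(LINT x:A|lebesgue. f x) = 0"
    have A: "A \<in> sets lebesgue" using compl(1) by (simp flip: gen)
    have "(LINT x:A \<union> (UNIV - A)|lebesgue. f x) = (LINT x:A|lebesgue. f x) + (LINT x:UNIV - A|lebesgue. f x)"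
      using A by (intro set_integral_Un si) auto
    with total compl(2) show "(LINT x:UNIV - A|lebesgue. f x) = 0" by simp
  next
    fix A :: "nat \<Rightarrow> real set"
    assume union: "disjoint_family A" "range A \<subseteq> sigma_sets UNIV (range (\<lambda>a::real. {a..}))"
      "\<And>n. (LINT x:A n|lebesgue. f x) = 0"
    have A: "A n \<in> sets lebesgue" for n using union(2) by (auto simp flip: gen)
    have "(LINT x:(\<Union>n. A n)|lebesgue. f x) = (\<Sum>n. LINT x:A n|lebesgue. f x)"
      using union(1) A by (intro lebesgue_integral_countable_add si) (auto simp: disjoint_family_on_def)
    with union(3) show "(LINT x:(\<Union>n. A n)|lebesgue. f x) = 0" by simp
  next
    have "{a..} \<inter> {b..} = {max a b..}" for a b :: real by auto
    then show "Int_stable (range (\<lambda>a::real. {a..}))"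
      by (auto simp: Int_stable_def)
  qed (auto simp: rays set_lebesgue_integral_def[of _ "{}"])
  fix A :: "real set" assume A: "A \<in> sets lebesgue"
  \<comment> \<open>A Lebesgue set differs from a Borel set by a null set.\<close>
  then obtain S N N' where S: "A = S \<union> N" "N \<subseteq> N'" "N' \<in> null_sets lborel" "S \<in> sets lborel"
    by (rule sets_completionE)
  have "N' \<in> null_sets lebesgue" using S(3) by (rule null_sets_completionI)
  then have "AE x in lebesgue. x \<in> S \<longleftrightarrow> x \<in> A"
    using S by (intro AE_I'[of N']) auto
  then have "(LINT x:A|lebesgue. f x) = (LINT x:S|lebesgue. f x)"
    using S A by (intro set_integral_cong_set sb) auto
  also have "\<dots> = 0" using S(4) by (intro borel) (simp flip: gen)
  finally show "(LINT x:A|lebesgue. f x) = 0" .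
qed

text \<open>Extend \<open>g\<close> by zero. Its integral over \<open>{a..}\<close> is then the
  increment over \<open>{max 0 a..T}\<close> of the primitive, which vanishes identically.\<close>

lemma L2_AE_zero_if_primitive_zero:
  fixes g :: "real \<Rightarrow> 'a::euclidean_space"
  assumes g: "g \<in> L2_space T" and z: "\<And>t. t \<in> {0..T} \<Longrightarrow> integral {0..t} g = 0"
  shows "AE t in lebesgue_on {0..T}. g t = 0"
proof (cases "0 \<le> T")
  case True
  define f where "f t = indicator {0..T} t *\<^sub>R g t" for t
  have f: "integrable lebesgue f"
    using L2_integrable[OF g] unfolding f_def by (simp add: integrable_restrict_space)
  have pair: "H1_pair T (\<lambda>t. 0) g" using g z by (simp add: H1_pair_def)
  have "(LINT x:{a..}|lebesgue. f x) = 0" for a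
  proof -
    have "set_integrable lebesgue {a..} f"
      unfolding set_integrable_def by (rule integrable_mult_indicator[OF _ f]) simp
    then have "(LINT x:{a..}|lebesgue. f x) = integral {a..} f"
      by (rule set_lebesgue_integral_eq_integral)
    also have "\<dots> = integral {a..} (\<lambda>t. if t \<in> {0..T} then g t else 0)"
      by (intro arg_cong2[where f=integral] refl ext) (simp add: f_def)
    also have "\<dots> = integral ({0..T} \<inter> {a..}) g" by (rule integral_restrict_Int)
    also have "{0..T} \<inter> {a..} = {max 0 a..T}" by auto
    also have "integral \<dots> g = 0"
    proof (cases "max 0 a \<le> T")
      case True
      then show ?thesis using H1_pair_increment[OF pair, of "max 0 a" T] by simp
    qed simp
    finally show ?thesis .
  qed
  from AE_zero_if_integral_atLeast_zero[OF f this]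
  have "AE t in lebesgue. t \<in> {0..T} \<longrightarrow> g t = 0" by (auto simp: f_def)
  then show ?thesis by (subst AE_restrict_space_iff) auto
qed (simp add: AE_restrict_space_iff)

lemma H1_pair_unique:
  assumes "H1_pair T x g" "H1_pair T x h"
  shows "AE t in lebesgue_on {0..T}. g t = h t"
proof -
  have d: "H1_pair T (\<lambda>t. x t - x t) (\<lambda>t. g t - h t)" by (rule H1_pair_diff[OF assms])
  have "AE t in lebesgue_on {0..T}. g t - h t = 0"
    by (rule L2_AE_zero_if_primitive_zero[OF H1_pair_L2[OF d]])
      (use H1_pair_eq[OF d] in simp)
  then show ?thesis by simp
qed

lemma H1_space_pair:
  assumes "0 < T" "x \<in> H1_space T"
  shows "H1_pair T x (wderiv T x)"
proof -
  have x: "\<exists>g. is_weak_derivative T x g" "continuous_on {0..T} x"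
    using assms(2) by (auto simp: H1_space_def)
  show ?thesis
    unfolding wderiv_def by (rule weak_derivative_imp_H1_pair[OF assms(1) x(2) someI_ex[OF x(1)]])
qed

lemma H1_pair_space: "0 < T \<Longrightarrow> H1_pair T x g \<Longrightarrow> x \<in> H1_space T"
  unfolding H1_space_def using H1_pair_continuous H1_pair_imp_weak_derivative by blast

text \<open>Two densities of one state differ by a function with vanishing primitive. So any
  explicitly known density may replace the choice made in \<open>wderiv\<close>, up to a null
  set.\<close>

lemma H1_pair_wderiv:
  assumes "0 < T" "H1_pair T x g"
  shows "AE t in lebesgue_on {0..T}. wderiv T x t = g t"
  by (rule H1_pair_unique[OF H1_space_pair[OF assms(1) H1_pair_space[OF assms]] assms(2)])

section \<open>Coercivity, Gronwall estimates and \<open>L\<^sup>2\<close> limits\<close>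

lemma matrix_inv_cancel:
  fixes P :: "real^'k^'k"
  assumes "invertible P"
  shows "P *v (matrix_inv P *v u) = u" "matrix_inv P *v (P *v u) = u"
proof -
  have "P ** matrix_inv P = mat 1 \<and> matrix_inv P ** P = mat 1"
    using assms unfolding invertible_def matrix_inv_def by (rule someI_ex)
  then show "P *v (matrix_inv P *v u) = u" "matrix_inv P *v (P *v u) = u"
    by (simp_all add: matrix_vector_mul_assoc)
qed

lemma covariance_inner_commute:
  assumes "covariance_matrix P" shows "(P *v a) \<bullet> b = a \<bullet> (P *v b)"
  using assms unfolding covariance_matrix_def
  by (metis dot_lmul_matrix inner_commute transpose_matrix_vector)

lemma covariance_inverse_inner_commute:
  assumes "covariance_matrix P" "invertible P"
  shows "(matrix_inv P *v a) \<bullet> b = a \<bullet> (matrix_inv P *v b)"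
  using covariance_inner_commute[OF assms(1), of "matrix_inv P *v a" "matrix_inv P *v b"]
  by (simp add: matrix_inv_cancel[OF assms(2)])

text \<open>With \<open>z = P\<^sup>-\<^sup>1 u\<close> and \<open>p \<ge> norm P\<close>, evaluating the form of \<open>P\<close> at \<open>z - u / p\<close> bounds
  \<open>P\<^sup>-\<^sup>1 u \<bullet> u\<close> from below by \<open>(norm u)\<^sup>2 / p\<close>.\<close>

lemma covariance_inverse_coercive:
  fixes P :: "real^'k^'k"
  assumes "covariance_matrix P" "invertible P"
  obtains c where "c > 0" "\<And>u. c * (norm u)\<^sup>2 \<le> (matrix_inv P *v u) \<bullet> u"
proof
  define p where "p = norm P + 1"
  have p: "p > 0" "norm P \<le> p" by (simp_all add: p_def add_nonneg_pos)
  show "1 / p > 0" using p by simp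
  fix u
  define z where "z = matrix_inv P *v u"
  have Pz: "P *v z = u" by (simp add: z_def matrix_inv_cancel[OF assms(2)])
  have "0 \<le> (P *v (z - (1 / p) *\<^sub>R u)) \<bullet> (z - (1 / p) *\<^sub>R u)"
    using assms(1) by (simp add: covariance_matrix_def)
  also have "\<dots> = z \<bullet> u - 2 / p * (norm u)\<^sup>2 + (1 / p)\<^sup>2 * ((P *v u) \<bullet> u)"
  proof -
    have "(P *v u) \<bullet> z = u \<bullet> u"
      using covariance_inner_commute[OF assms(1), of u z] by (simp add: Pz)
    then show ?thesis
      unfolding power2_norm_eq_inner
      by (simp add: matrix_vector_mult_diff_distrib matrix_vector_mult_scaleR Pz inner_diff_left inner_diff_right
          inner_commute[of u z] power2_eq_square algebra_simps)
  qed
  also have "(P *v u) \<bullet> u \<le> p * (norm u)\<^sup>2"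
  proof -
    have "(P *v u) \<bullet> u \<le> norm (P *v u) * norm u" by (rule norm_cauchy_schwarz)
    also have "\<dots> \<le> (p * norm u) * norm u"
      by (intro mult_right_mono order_trans[OF norm_matrix_vector_mult_le] p) auto
    finally show ?thesis by (simp add: power2_eq_square)
  qed
  finally have "0 \<le> z \<bullet> u - 2 / p * (norm u)\<^sup>2 + (1 / p)\<^sup>2 * (p * (norm u)\<^sup>2)"
    by (simp add: mult_left_mono)
  then show "1 / p * (norm u)\<^sup>2 \<le> (matrix_inv P *v u) \<bullet> u"
    using p by (simp add: z_def power2_eq_square field_simps)
qed

lemma H1_space_scaled_add:
  assumes "0 < T" "x \<in> H1_space T" "y \<in> H1_space T"
  shows "(\<lambda>t. x t + c *\<^sub>R y t) \<in> H1_space T"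
    and "AE t in lebesgue_on {0..T}. wderiv T (\<lambda>t. x t + c *\<^sub>R y t) t = wderiv T x t + c *\<^sub>R wderiv T y t"
  using H1_pair_linear[OF H1_space_pair[OF assms(1,2)] H1_space_pair[OF assms(1,3)], of c]
  by (auto intro: H1_pair_space[OF assms(1)] dest: H1_pair_wderiv[OF assms(1)])

lemma H1_space_diff:
  assumes "0 < T" "x \<in> H1_space T" "y \<in> H1_space T"
  shows "(\<lambda>t. x t - y t) \<in> H1_space T"
    and "AE t in lebesgue_on {0..T}. wderiv T (\<lambda>t. x t - y t) t = wderiv T x t - wderiv T y t"
  using H1_space_scaled_add[OF assms, of "-1"] by simp_all

lemma H1_wderiv_L2: "0 < T \<Longrightarrow> x \<in> H1_space T \<Longrightarrow> wderiv T x \<in> L2_space T"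
  by (rule H1_pair_L2[OF H1_space_pair])

lemma H1_state_L2: "0 < T \<Longrightarrow> x \<in> H1_space T \<Longrightarrow> x \<in> L2_space T"
  by (rule H1_pair_state_L2[OF H1_space_pair])

section \<open>Gronwall's inequality and the energy estimate\<close>

lemma integral_norm_L2_bound:
  assumes "0 \<le> T" "f \<in> L2_space T" "t \<in> {0..T}"
  shows "(\<lambda>s. norm (f s)) integrable_on {0..t}" "integral {0..t} (\<lambda>s. norm (f s)) \<le> sqrt T * L2_norm T f"
proof -
  have int: "integrable (lebesgue_on {0..T}) (\<lambda>s. norm (f s))"
    by (intro integrable_norm L2_integrable assms)
  then have on: "(\<lambda>s. norm (f s)) integrable_on {0..T}"
    by (rule integrable_on_lebesgue_on) simp
  then show sub: "(\<lambda>s. norm (f s)) integrable_on {0..t}"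
    by (rule integrable_on_subinterval) (use assms(3) in auto)
  have "integral {0..t} (\<lambda>s. norm (f s)) \<le> integral {0..T} (\<lambda>s. norm (f s))"
    by (rule integral_subset_le[OF _ sub on]) (use assms(3) in auto)
  also have "\<dots> = (LINT s|lebesgue_on {0..T}. norm (f s))"
    by (rule lebesgue_integral_eq_integral[OF int, symmetric]) simp
  also have "\<dots> \<le> sqrt T * L2_norm T f" by (rule L2_norm_integral_bound[OF assms(1,2)])
  finally show "integral {0..t} (\<lambda>s. norm (f s)) \<le> sqrt T * L2_norm T f" .
qed

text \<open>Gronwall's inequality: the maximum \<open>m\<close> of \<open>exp (- 2 a t) * norm (x t)\<close> satisfies
  \<open>m \<le> c + m / 2\<close>.\<close>

lemma H1_gronwall:
  fixes x :: "real \<Rightarrow> real^'n" and A :: "real^'n^'n"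
  assumes "0 < T" "0 < a" "norm A \<le> a" and x: "H1_pair T x (\<lambda>t. A *v x t + f t)"
    and f: "f \<in> L2_space T" and t: "t \<in> {0..T}"
  shows "norm (x t) \<le> 2 * exp (2 * a * T) * (norm (x 0) + sqrt T * L2_norm T f)"
proof -
  define c where "c = norm (x 0) + sqrt T * L2_norm T f"
  have c0: "0 \<le> c" using assms(1) by (simp add: c_def L2_norm_nonneg)
  have "continuous_on {0..T} (\<lambda>t. exp (- (2 * a * t)) * norm (x t))"
    by (intro continuous_intros H1_pair_continuous[OF x])
  from continuous_attains_sup[OF _ _ this] obtain \<tau>
    where \<tau>: "\<tau> \<in> {0..T}" "\<And>s. s \<in> {0..T} \<Longrightarrow> exp (- (2 * a * s)) * norm (x s) \<le> exp (- (2 * a * \<tau>)) * norm (x \<tau>)"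
    using assms(1) by auto
  define m where "m = exp (- (2 * a * \<tau>)) * norm (x \<tau>)"
  have m0: "0 \<le> m" by (simp add: m_def)
  have xm: "norm (x s) \<le> m * exp (2 * a * s)" if "s \<in> {0..T}" for s
    using \<tau>(2)[OF that] by (simp add: m_def exp_minus field_simps)
  have xt: "norm (x \<tau>) = m * exp (2 * a * \<tau>)" by (simp add: m_def exp_minus field_simps)
  note fb = integral_norm_L2_bound[OF less_imp_le[OF assms(1)] f \<tau>(1)]
  \<comment> \<open>Integrating the exponential divides by \<open>2 * a\<close>, which against the
    factor \<open>a\<close> leaves one half. This is the reason for the exponent
    \<open>2 * a\<close> of the weight: the resulting term can be absorbed on the left.\<close>
  have E: "((\<lambda>s. a * m * exp (2 * a * s)) has_integral m * exp (2 * a * \<tau>) / 2 - m * exp (2 * a * 0) / 2) {0..\<tau>}"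
    using \<tau>(1) assms(2)
    by (intro fundamental_theorem_of_calculus)
      (auto intro!: derivative_eq_intros simp flip: has_real_derivative_iff_has_vector_derivative)
  have "norm (integral {0..\<tau>} (\<lambda>s. A *v x s + f s)) \<le> integral {0..\<tau>} (\<lambda>s. a * m * exp (2 * a * s) + norm (f s))"
  proof (rule Henstock_Kurzweil_Integration.integral_norm_bound_integral)
    show "(\<lambda>s. A *v x s + f s) integrable_on {0..\<tau>}"
      using \<tau>(1) by (intro L2_integrable_on_subinterval[OF H1_pair_L2[OF x]]) auto
    show "(\<lambda>s. a * m * exp (2 * a * s) + norm (f s)) integrable_on {0..\<tau>}"
      by (rule integrable_add[OF has_integral_integrable[OF E] fb(1)])
    fix s assume "s \<in> {0..\<tau>}"
    then have s: "s \<in> {0..T}" using \<tau>(1) by auto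
    have "norm (A *v x s) \<le> a * (m * exp (2 * a * s))"
      using norm_matrix_vector_mult_le[of A "x s"] mult_mono[OF assms(3) xm[OF s]] assms(2) by simp
    then show "norm (A *v x s + f s) \<le> a * m * exp (2 * a * s) + norm (f s)"
      using norm_triangle_ineq[of "A *v x s" "f s"] by simp
  qed
  also have "\<dots> = (m * exp (2 * a * \<tau>) / 2 - m / 2) + integral {0..\<tau>} (\<lambda>s. norm (f s))"
    using integral_unique[OF E]
    by (simp add: Henstock_Kurzweil_Integration.integral_add[OF has_integral_integrable[OF E] fb(1)])
  also have "\<dots> \<le> (m * exp (2 * a * \<tau>) / 2) + sqrt T * L2_norm T f"
    using fb(2) m0 by simp
  finally have "norm (x \<tau>) \<le> c + m * exp (2 * a * \<tau>) / 2"
    using H1_pair_eq[OF x \<tau>(1)] norm_triangle_ineq[of "x 0" "integral {0..\<tau>} (\<lambda>s. A *v x s + f s)"]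
    by (simp add: c_def)
  then have "m * exp (2 * a * \<tau>) \<le> 2 * c" using xt by simp
  moreover have "m * 1 \<le> m * exp (2 * a * \<tau>)"
    using m0 assms(2) \<tau>(1) by (intro mult_left_mono) auto
  ultimately have "m \<le> 2 * c" by simp
  have "norm (x t) \<le> m * exp (2 * a * t)" by (rule xm[OF t])
  also have "\<dots> \<le> (2 * c) * exp (2 * a * T)"
    using \<open>m \<le> 2 * c\<close> c0 assms(2) t by (intro mult_mono) auto
  finally show ?thesis by (simp add: c_def algebra_simps)
qed

text \<open>Gronwall's factor \<open>2 * exp (2 * a * T) * (1 + sqrt T)\<close> bounds the supremum
  of the state, \<open>a * sqrt T\<close> passes from there to the L2 norm of
  \<open>A *v x t\<close>, and the summand 1 accounts for the forcing.\<close>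

definition energy_const :: "real \<Rightarrow> real \<Rightarrow> real" where
  "energy_const T a = a * sqrt T * (2 * exp (2 * a * T) * (1 + sqrt T)) + 1"

text \<open>Regard \<open>x\<close> as the solution of a linear equation with forcing
  \<open>f\<close>: Gronwall bounds the state by its initial value and \<open>f\<close>, and the
  equation itself then bounds the derivative.\<close>

lemma H1_energy:
  fixes x :: "real \<Rightarrow> real^'n" and A :: "real^'n^'n"
  assumes T: "0 < T" and a: "0 < a" "norm A \<le> a" and x: "x \<in> H1_space T"
  shows "L2_norm T (wderiv T x)
    \<le> energy_const T a * (norm (x 0) + L2_norm T (\<lambda>t. wderiv T x t - A *v x t))"
proof -
  define f where "f = (\<lambda>t. wderiv T x t - A *v x t)"
  note xL = H1_state_L2[OF T x] and gL = H1_wderiv_L2[OF T x]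
  have f: "f \<in> L2_space T" unfolding f_def by (intro L2_closed xL gL)
  define n where "n = norm (x 0) + L2_norm T f"
  have n: "norm (x 0) \<le> n" "L2_norm T f \<le> n" "0 \<le> n"
    by (simp_all add: n_def L2_norm_nonneg)
  have split: "wderiv T x t = A *v x t + f t" for t by (simp add: f_def)
  have p: "H1_pair T x (\<lambda>t. A *v x t + f t)"
    using H1_space_pair[OF T x] by (simp flip: split)
  define K where "K = 2 * exp (2 * a * T) * ((1 + sqrt T) * n)"
  have "norm (x t) \<le> K" if "t \<in> {0..T}" for t
  proof -
    have "norm (x 0) + sqrt T * L2_norm T f \<le> (1 + sqrt T) * n"
      using n(1) mult_left_mono[OF n(2) real_sqrt_ge_zero[OF less_imp_le[OF T]]]
      by (simp add: distrib_right)
    then show ?thesis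
      unfolding K_def by (intro order_trans[OF H1_gronwall[OF T a p f that]] mult_left_mono) auto
  qed
  moreover have K0: "0 \<le> K" using n T by (simp add: K_def)
  ultimately have "L2_norm T x \<le> sqrt T * K"
    using T by (intro L2_norm_sup_bound xL) auto
  then have "norm A * L2_norm T x \<le> a * (sqrt T * K)"
    using a by (intro mult_mono) (auto simp: L2_norm_nonneg)
  moreover have "L2_norm T (wderiv T x) \<le> L2_norm T (\<lambda>t. A *v x t) + L2_norm T f"
    using L2_norm_triangle[OF L2_matrix[OF xL, of A] f] by (simp flip: split)
  ultimately have "L2_norm T (wderiv T x) \<le> a * (sqrt T * K) + n"
    using L2_norm_matrix[OF xL, of A] n(2) by linarith
  also have "\<dots> = energy_const T a * n" by (simp add: energy_const_def K_def algebra_simps)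
  finally show ?thesis by (simp add: n_def f_def)
qed

text \<open>\<open>Z_norm\<close> sees a state only through \<open>x 0\<close> and its derivative;
  this recovers the L2 norm of the state from them.\<close>

lemma H1_norm_bound:
  assumes T: "0 < T" and x: "x \<in> H1_space T"
  shows "L2_norm T x \<le> sqrt T * (norm (x 0) + sqrt T * L2_norm T (wderiv T x))"
proof (rule L2_norm_sup_bound)
  fix t assume t: "t \<in> {0..T}"
  note p = H1_space_pair[OF T x]
  note b = integral_norm_L2_bound[OF less_imp_le[OF T] H1_pair_L2[OF p] t]
  have "norm (integral {0..t} (wderiv T x)) \<le> integral {0..t} (\<lambda>s. norm (wderiv T x s))"
    using t by (intro Henstock_Kurzweil_Integration.integral_norm_bound_integral b
        L2_integrable_on_subinterval[OF H1_pair_L2[OF p]]) auto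
  then show "norm (x t) \<le> norm (x 0) + sqrt T * L2_norm T (wderiv T x)"
    using H1_pair_eq[OF p t] norm_triangle_ineq[of "x 0" "integral {0..t} (wderiv T x)"] b(2) by simp
qed (use T H1_state_L2[OF T x] in \<open>auto simp: L2_norm_nonneg\<close>)

section \<open>Limits in L2\<close>

text \<open>Membership is part of the notion so that the limit rules compose.\<close>

definition L2_lim :: "real \<Rightarrow> (nat \<Rightarrow> real \<Rightarrow> 'a::euclidean_space) \<Rightarrow> (real \<Rightarrow> 'a) \<Rightarrow> bool" where
  "L2_lim T f g \<longleftrightarrow> (\<forall>k. f k \<in> L2_space T) \<and> g \<in> L2_space T \<and>
     (\<lambda>k. L2_norm T (\<lambda>t. f k t - g t)) \<longlonglongrightarrow> 0"

lemma L2_lim_const: "f \<in> L2_space T \<Longrightarrow> L2_lim T (\<lambda>k. f) f"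
  by (simp add: L2_lim_def L2_norm_def)

lemma tendsto_0_le:
  fixes f g :: "nat \<Rightarrow> real"
  assumes "g \<longlonglongrightarrow> 0" "\<And>k. 0 \<le> f k" "\<And>k. f k \<le> g k"
  shows "f \<longlonglongrightarrow> 0"
  by (rule tendsto_sandwich[OF _ _ tendsto_const assms(1)]) (use assms(2,3) in auto)

lemma L2_limI:
  assumes "\<And>k. f k \<in> L2_space T" "g \<in> L2_space T"
    and "b \<longlonglongrightarrow> 0" "\<And>k. L2_norm T (\<lambda>t. f k t - g t) \<le> b k"
  shows "L2_lim T f g"
  using assms tendsto_0_le[OF assms(3) L2_norm_nonneg assms(4)] by (simp add: L2_lim_def)

lemma L2_lim_diff:
  assumes "L2_lim T f g" "L2_lim T f' g'"
  shows "L2_lim T (\<lambda>k t. f k t - f' k t) (\<lambda>t. g t - g' t)"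
proof (rule L2_limI)
  show "(\<lambda>k. L2_norm T (\<lambda>t. f k t - g t) + L2_norm T (\<lambda>t. f' k t - g' t)) \<longlonglongrightarrow> 0"
    using assms tendsto_add[of _ 0 _ _ 0] by (force simp: L2_lim_def)
  fix k
  have "L2_norm T (\<lambda>t. (f k t - g t) - (f' k t - g' t)) \<le> L2_norm T (\<lambda>t. f k t - g t) + L2_norm T (\<lambda>t. f' k t - g' t)"
    using assms by (intro L2_norm_triangle_diff L2_diff) (auto simp: L2_lim_def)
  then show "L2_norm T (\<lambda>t. (f k t - f' k t) - (g t - g' t)) \<le> L2_norm T (\<lambda>t. f k t - g t) + L2_norm T (\<lambda>t. f' k t - g' t)"
    by (simp add: algebra_simps)
qed (use assms in \<open>auto simp: L2_lim_def intro: L2_diff\<close>)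

text \<open>The difference splits into \<open>A k *v (f k t - g t)\<close> and
  \<open>(A k - A') *v g t\<close>; the first tends to zero because the factors
  \<open>norm (A k)\<close> converge.\<close>

lemma L2_lim_matrix:
  fixes A :: "nat \<Rightarrow> real^'n^'m"
  assumes "A \<longlonglongrightarrow> A'" "L2_lim T f g"
  shows "L2_lim T (\<lambda>k t. A k *v f k t) (\<lambda>t. A' *v g t)"
proof (rule L2_limI)
  have L: "f k \<in> L2_space T" "g \<in> L2_space T" "(\<lambda>k. L2_norm T (\<lambda>t. f k t - g t)) \<longlonglongrightarrow> 0" for k
    using assms(2) by (auto simp: L2_lim_def)
  have "(\<lambda>k. norm (A k - A')) \<longlonglongrightarrow> 0" using assms(1) by (simp add: LIM_zero_iff tendsto_norm_zero_iff)
  then show "(\<lambda>k. norm (A k) * L2_norm T (\<lambda>t. f k t - g t) + norm (A k - A') * L2_norm T g) \<longlonglongrightarrow> 0"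
    using tendsto_add[OF tendsto_mult[OF tendsto_norm[OF assms(1)] L(3)] tendsto_mult_left_zero, of "\<lambda>k. norm (A k - A')" "L2_norm T g"]
    by simp
  fix k
  have "L2_norm T (\<lambda>t. A k *v (f k t - g t) + (A k - A') *v g t)
      \<le> L2_norm T (\<lambda>t. A k *v (f k t - g t)) + L2_norm T (\<lambda>t. (A k - A') *v g t)"
    by (intro L2_norm_triangle L2_closed L)
  also have "\<dots> \<le> norm (A k) * L2_norm T (\<lambda>t. f k t - g t) + norm (A k - A') * L2_norm T g"
    by (intro add_mono L2_norm_matrix L2_diff L)
  finally show "L2_norm T (\<lambda>t. A k *v f k t - A' *v g t)
      \<le> norm (A k) * L2_norm T (\<lambda>t. f k t - g t) + norm (A k - A') * L2_norm T g"
    by (simp add: matrix_vector_mult_diff_distrib matrix_vector_mult_diff_rdistrib)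
  show "(\<lambda>t. A k *v f k t) \<in> L2_space T" "(\<lambda>t. A' *v g t) \<in> L2_space T"
    by (intro L2_matrix L)+
qed

lemma L2_lim_inner:
  assumes f: "L2_lim T f f'" and g: "L2_lim T g g'"
  shows "(\<lambda>k. L2_inner T (f k) (g k)) \<longlonglongrightarrow> L2_inner T f' g'"
proof -
  have L: "f k \<in> L2_space T" "f' \<in> L2_space T" "g k \<in> L2_space T" "g' \<in> L2_space T"
    "(\<lambda>k. L2_norm T (\<lambda>t. f k t - f' t)) \<longlonglongrightarrow> 0" "(\<lambda>k. L2_norm T (\<lambda>t. g k t - g' t)) \<longlonglongrightarrow> 0" for k
    using assms by (auto simp: L2_lim_def)
  let ?df = "\<lambda>k t. f k t - f' t" and ?dg = "\<lambda>k t. g k t - g' t"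
  have "(\<lambda>k. \<bar>L2_inner T (f k) (g k) - L2_inner T f' g'\<bar>) \<longlonglongrightarrow> 0"
  proof (rule tendsto_0_le)
    have "(\<lambda>k. L2_norm T (?df k) * (L2_norm T (?dg k) + L2_norm T g') + L2_norm T f' * L2_norm T (?dg k))
      \<longlonglongrightarrow> 0 * (0 + L2_norm T g') + L2_norm T f' * 0"
      by (intro tendsto_intros L)
    then show "(\<lambda>k. L2_norm T (?df k) * (L2_norm T (?dg k) + L2_norm T g') + L2_norm T f' * L2_norm T (?dg k)) \<longlonglongrightarrow> 0"
      by simp
    fix k
    have "L2_inner T (f k) (g k) - L2_inner T f' g'
      = L2_inner T (?df k) (?dg k) + L2_inner T (?df k) g' + L2_inner T f' (?dg k)"
      using L by (simp add: L2_inner_diff_left L2_inner_diff_right L2_diff)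
    moreover have "\<bar>L2_inner T (?df k) (?dg k)\<bar> \<le> L2_norm T (?df k) * L2_norm T (?dg k)"
      "\<bar>L2_inner T (?df k) g'\<bar> \<le> L2_norm T (?df k) * L2_norm T g'"
      "\<bar>L2_inner T f' (?dg k)\<bar> \<le> L2_norm T f' * L2_norm T (?dg k)"
      by (intro L2_Cauchy_Schwarz L2_diff L)+
    ultimately show "\<bar>L2_inner T (f k) (g k) - L2_inner T f' g'\<bar>
      \<le> L2_norm T (?df k) * (L2_norm T (?dg k) + L2_norm T g') + L2_norm T f' * L2_norm T (?dg k)"
      unfolding distrib_left by linarith
  qed simp
  then show ?thesis by (simp add: tendsto_rabs_zero_iff LIM_zero_iff)
qed

text \<open>Row \<open>i\<close> of the outer product is \<open>a $ i\<close> times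
  \<open>b\<close>, so its Frobenius norm is exactly \<open>norm a * norm b\<close>.\<close>

lemma bounded_bilinear_outer_product: "bounded_bilinear (outer_product :: real^'n \<Rightarrow> real^'k \<Rightarrow> real^'k^'n)"
proof -
  have "norm (outer_product a b) \<le> norm a * norm b" for a :: "real^'n" and b :: "real^'k"
  proof -
    have "outer_product a b $ i = a $ i *\<^sub>R b" for i
      by (simp add: outer_product_def vec_eq_iff)
    then have "norm (outer_product a b) = L2_set (\<lambda>i. norm (a $ i) * norm b) UNIV"
      by (simp add: norm_vec_def[of "outer_product a b"])
    also have "\<dots> = norm a * norm b" by (simp add: norm_vec_def[of a] L2_set_left_distrib)
    finally show ?thesis by simp
  qed
  then show ?thesis
    by (intro bounded_bilinear.intro exI[of _ 1]) (auto simp: outer_product_def vec_eq_iff algebra_simps)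
qed

lemma inner_outer_product: "E \<bullet> outer_product a b = a \<bullet> (E *v b)"
  by (simp add: inner_vec_def outer_product_def matrix_vector_mult_def sum_distrib_left mult_ac)

text \<open>Pairing with \<open>E\<close> turns the matrix-valued integral of the optimality
  conditions into the inner product that occurs in the derivative of \<open>L\<close> in direction
  \<open>E\<close>.\<close>

lemma integral_outer_product_inner:
  fixes E :: "real^'k^'n"
  assumes "f \<in> L2_space T" "g \<in> L2_space T"
  shows "E \<bullet> (LINT t|lebesgue_on {0..T}. outer_product (f t) (g t)) = L2_inner T f (\<lambda>t. E *v g t)"
proof -
  have "integrable (lebesgue_on {0..T}) (\<lambda>t. outer_product (f t) (g t))"
    by (rule L2_bilinear_integrable[OF bounded_bilinear_outer_product assms])
  then show ?thesis
    by (simp add: L2_inner_def inner_outer_product flip: integral_inner_right)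
qed

section \<open>Quadratic expansion and stationarity\<close>

text \<open>Symmetry makes the mixed terms equal. A polynomial in \<open>s\<close> without remainder
  is what yields an exact cost decrement.\<close>

lemma L2_quadratic_form_expand:
  fixes P :: "real^'k^'k"
  assumes f: "f \<in> L2_space T" and g: "g \<in> L2_space T" and sym: "\<And>a b. (P *v a) \<bullet> b = a \<bullet> (P *v b)"
  shows "L2_inner T (\<lambda>t. P *v (f t + s *\<^sub>R g t)) (\<lambda>t. f t + s *\<^sub>R g t)
    = L2_inner T (\<lambda>t. P *v f t) f + s * (2 * L2_inner T (\<lambda>t. P *v f t) g) + s\<^sup>2 * L2_inner T (\<lambda>t. P *v g t) g"
proof -
  have "L2_inner T (\<lambda>t. P *v g t) f = L2_inner T (\<lambda>t. P *v f t) g"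
    unfolding L2_inner_def by (rule Bochner_Integration.integral_cong) (metis sym inner_commute)+
  then show ?thesis
    using f g
    by (simp add: matrix_vector_right_distrib matrix_vector_mult_scaleR L2_inner_add_left L2_inner_add_right
        L2_inner_scaleR_left L2_inner_scaleR_right L2_closed power2_eq_square algebra_simps)
qed

lemma L2_norm_power2_expand:
  assumes f: "f \<in> L2_space T" and g: "g \<in> L2_space T"
  shows "(L2_norm T (\<lambda>t. f t + s *\<^sub>R g t))\<^sup>2 = (L2_norm T f)\<^sup>2 + s * (2 * L2_inner T f g) + s\<^sup>2 * (L2_norm T g)\<^sup>2"
  using assms by (subst L2_norm_power2_add)
    (simp_all add: L2_scaleR L2_inner_scaleR_right L2_norm_scaleR power_mult_distrib)

lemma quadratic_form_expand:
  fixes P :: "real^'k^'k"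
  assumes sym: "\<And>a b. (P *v a) \<bullet> b = a \<bullet> (P *v b)"
  shows "(P *v (a + s *\<^sub>R b)) \<bullet> (a + s *\<^sub>R b)
    = (P *v a) \<bullet> a + s * (2 * ((P *v a) \<bullet> b)) + s\<^sup>2 * ((P *v b) \<bullet> b)"
proof -
  have "(P *v b) \<bullet> a = (P *v a) \<bullet> b" by (metis sym inner_commute)
  then show ?thesis
    by (simp add: matrix_vector_right_distrib matrix_vector_mult_scaleR inner_add_left inner_add_right
        power2_eq_square algebra_simps)
qed

lemma norm_power2_expand:
  fixes a b :: "'a::real_inner"
  shows "(norm (a + s *\<^sub>R b))\<^sup>2 = (norm a)\<^sup>2 + s * (2 * (a \<bullet> b)) + s\<^sup>2 * (norm b)\<^sup>2"
  unfolding power2_norm_eq_inner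
  by (simp add: inner_add_left inner_add_right inner_commute power2_eq_square algebra_simps)

text \<open>Nonnegativity of \<open>s * b + s\<^sup>2 * c\<close> for all \<open>s\<close> leaves
  the discriminant bound \<open>b\<^sup>2 \<le> 0\<close>.\<close>

lemma quadratic_min_linear_coeff_zero:
  fixes b c :: real
  assumes "\<And>s. f \<le> f + s * b + s\<^sup>2 * c"
  shows "b = 0"
proof -
  have "b\<^sup>2 \<le> 4 * 0 * c"
    by (rule quadratic_nonneg_discriminant) (use assms in \<open>simp add: add.assoc\<close>)
  then show ?thesis by simp
qed

lemma le_sqrt_of_square_le:
  fixes z :: real
  assumes "c > 0" "c * z\<^sup>2 \<le> b" shows "z \<le> sqrt (b / c)"
proof -
  have "z\<^sup>2 \<le> b / c" using assms by (simp add: field_simps)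
  then show ?thesis by (rule real_le_rsqrt)
qed

lemma tendsto_0_of_square_le:
  fixes z b :: "nat \<Rightarrow> real"
  assumes "c > 0" "\<And>n. 0 \<le> z n" "\<And>n. c * (z n)\<^sup>2 \<le> b n" "b \<longlonglongrightarrow> 0"
  shows "z \<longlonglongrightarrow> 0"
proof (rule tendsto_0_le)
  have "(\<lambda>n. sqrt (b n / c)) \<longlonglongrightarrow> sqrt (0 / c)"
    by (intro tendsto_intros assms) (use assms(1) in simp)
  then show "(\<lambda>n. sqrt (b n / c)) \<longlonglongrightarrow> 0" by simp
qed (use assms le_sqrt_of_square_le in auto)

lemma Z_norm_eq:
  "Z_norm T (E, F, h, k) = sqrt ((norm E)\<^sup>2 + (norm F)\<^sup>2 + (norm (h 0))\<^sup>2
    + (L2_norm T (wderiv T h))\<^sup>2 + (L2_norm T k)\<^sup>2)"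
  by (simp add: Z_norm_def trace_add trace_mult_transpose L2_norm_power2)

text \<open>Together with \<open>Z_norm_components\<close> this makes convergence in
  \<open>Z_norm\<close> the same as convergence of the five components.\<close>

lemma Z_norm_le:
  "Z_norm T (E, F, h, k) \<le> norm E + norm F + norm (h 0) + L2_norm T (wderiv T h) + L2_norm T k"
proof -
  have *: "sqrt (a\<^sup>2 + b\<^sup>2 + c\<^sup>2 + d\<^sup>2 + e\<^sup>2) \<le> a + b + c + d + e"
    if "0 \<le> a" "0 \<le> b" "0 \<le> c" "0 \<le> d" "0 \<le> e" for a b c d e :: real
  proof (rule real_le_lsqrt)
    \<comment> \<open>These four products add up to half of the mixed terms in the expanded
      square.\<close>
    have "0 \<le> a * b" "0 \<le> (a + b) * c" "0 \<le> (a + b + c) * d" "0 \<le> (a + b + c + d) * e"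
      using that by simp_all
    then show "a\<^sup>2 + b\<^sup>2 + c\<^sup>2 + d\<^sup>2 + e\<^sup>2 \<le> (a + b + c + d + e)\<^sup>2"
      by (simp add: power2_eq_square algebra_simps)
  qed (use that in simp)
  show ?thesis unfolding Z_norm_eq by (rule *) (simp_all add: L2_norm_nonneg)
qed

lemma Z_norm_components:
  "norm E \<le> Z_norm T (E, F, h, k)" "norm F \<le> Z_norm T (E, F, h, k)" "norm (h 0) \<le> Z_norm T (E, F, h, k)"
  "L2_norm T (wderiv T h) \<le> Z_norm T (E, F, h, k)" "L2_norm T k \<le> Z_norm T (E, F, h, k)"
  unfolding Z_norm_eq
  by (rule real_le_rsqrt; simp)+

section \<open>First and second variations of the functionals\<close>

locale assimilation =
  fixes T \<alpha> \<beta> :: real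
    and A0 :: "real^'n^'n" and B0 :: "real^'d^'n" and G :: "real^'m^'n" and C :: "real^'n^'p"
    and x0 :: "real^'n" and \<Pi>0 :: "real^'n^'n" and Q :: "real^'m^'m" and R :: "real^'p^'p"
    and v :: "real \<Rightarrow> real^'d" and y :: "real \<Rightarrow> real^'p"
  assumes T: "0 < T" and \<alpha>: "0 < \<alpha>" and \<beta>: "0 < \<beta>"
    and \<Pi>0: "covariance_matrix \<Pi>0" "invertible \<Pi>0"
    and Q: "covariance_matrix Q" "invertible Q"
    and R: "covariance_matrix R" "invertible R"
    and v: "v \<in> L2_space T" and y: "y \<in> L2_space T"
begin

abbreviation "J \<equiv> J_functional T \<alpha> \<beta> A0 B0 G C x0 \<Pi>0 Q R v y"
abbreviation "K \<equiv> K_functional T \<beta> G C x0 \<Pi>0 Q R v y"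
abbreviation "L \<equiv> L_functional T \<alpha> \<beta> A0 B0 G v"
abbreviation "res A B x w \<equiv> residual T G v (A, B, x, w)"
abbreviation "misfit x \<equiv> (\<lambda>t. y t - C *v x t)"

text \<open>
  \<open>dyn\<close> is the part of the residual that is linear in state and noise. \<open>DK\<close> and \<open>QK\<close> are the first and
  second order coefficients of \<open>K\<close> along a direction \<open>(h, k)\<close>, \<open>DL\<close> and \<open>QL\<close> those of \<open>L\<close> along \<open>(E, F)\<close>.
\<close>

definition dyn :: "real^'n^'n \<Rightarrow> (real \<Rightarrow> real^'n) \<Rightarrow> (real \<Rightarrow> real^'m) \<Rightarrow> real \<Rightarrow> real^'n" where
  "dyn A h k = (\<lambda>t. wderiv T h t - A *v h t - G *v k t)"

definition DK :: "real^'n^'n \<Rightarrow> real^'d^'n \<Rightarrow> (real \<Rightarrow> real^'n) \<Rightarrow> (real \<Rightarrow> real^'m)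
    \<Rightarrow> (real \<Rightarrow> real^'n) \<Rightarrow> (real \<Rightarrow> real^'m) \<Rightarrow> real" where
  "DK A B x w h k = (matrix_inv \<Pi>0 *v (x 0 - x0)) \<bullet> h 0 + \<beta> * L2_inner T (res A B x w) (dyn A h k)
    + L2_inner T (\<lambda>t. matrix_inv Q *v w t) k
    - L2_inner T (\<lambda>t. matrix_inv R *v misfit x t) (\<lambda>t. C *v h t)"

definition QK :: "real^'n^'n \<Rightarrow> (real \<Rightarrow> real^'n) \<Rightarrow> (real \<Rightarrow> real^'m) \<Rightarrow> real" where
  "QK A h k = 1 / 2 * ((matrix_inv \<Pi>0 *v h 0) \<bullet> h 0) + \<beta> / 2 * (L2_norm T (dyn A h k))\<^sup>2
    + 1 / 2 * L2_inner T (\<lambda>t. matrix_inv Q *v k t) k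
    + 1 / 2 * L2_inner T (\<lambda>t. matrix_inv R *v (C *v h t)) (\<lambda>t. C *v h t)"

definition DL :: "real^'n^'n \<Rightarrow> real^'d^'n \<Rightarrow> (real \<Rightarrow> real^'n) \<Rightarrow> (real \<Rightarrow> real^'m)
    \<Rightarrow> real^'n^'n \<Rightarrow> real^'d^'n \<Rightarrow> real" where
  "DL A B x w E F = \<alpha> * ((A - A0) \<bullet> E + (B - B0) \<bullet> F)
    - \<beta> * L2_inner T (res A B x w) (\<lambda>t. E *v x t + F *v v t)"

definition QL :: "(real \<Rightarrow> real^'n) \<Rightarrow> real^'n^'n \<Rightarrow> real^'d^'n \<Rightarrow> real" where
  "QL x E F = \<alpha> / 2 * ((norm E)\<^sup>2 + (norm F)\<^sup>2) + \<beta> / 2 * (L2_norm T (\<lambda>t. E *v x t + F *v v t))\<^sup>2"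

lemma K_eq: "K (A, B, x, w) = 1 / 2 * ((matrix_inv \<Pi>0 *v (x 0 - x0)) \<bullet> (x 0 - x0))
    + \<beta> / 2 * (L2_norm T (res A B x w))\<^sup>2
    + 1 / 2 * L2_inner T (\<lambda>t. matrix_inv Q *v w t) w
    + 1 / 2 * L2_inner T (\<lambda>t. matrix_inv R *v misfit x t) (misfit x)"
  by (simp add: K_functional_def L2_norm_power2 L2_inner_def)

lemma L_eq: "L (A, B, x, w) = \<alpha> / 2 * ((norm (A - A0))\<^sup>2 + (norm (B - B0))\<^sup>2)
    + \<beta> / 2 * (L2_norm T (res A B x w))\<^sup>2"
  by (simp add: L_functional_def L2_norm_power2 trace_add trace_mult_transpose)

lemma J_eq_K: "J (A, B, x, w) = \<alpha> / 2 * ((norm (A - A0))\<^sup>2 + (norm (B - B0))\<^sup>2) + K (A, B, x, w)"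
  by (simp add: J_functional_def K_functional_def trace_add trace_mult_transpose)

lemma J_eq_L: "J (A, B, x, w) = L (A, B, x, w) + 1 / 2 * ((matrix_inv \<Pi>0 *v (x 0 - x0)) \<bullet> (x 0 - x0))
    + 1 / 2 * L2_inner T (\<lambda>t. matrix_inv Q *v w t) w
    + 1 / 2 * L2_inner T (\<lambda>t. matrix_inv R *v misfit x t) (misfit x)"
  by (simp add: J_eq_K K_eq L_eq)

lemma res_L2: "x \<in> H1_space T \<Longrightarrow> w \<in> L2_space T \<Longrightarrow> res A B x w \<in> L2_space T"
  unfolding residual_def prod.case using H1_wderiv_L2[OF T, of x] H1_state_L2[OF T, of x]
  by (intro L2_closed v)

lemma dyn_L2: "h \<in> H1_space T \<Longrightarrow> k \<in> L2_space T \<Longrightarrow> dyn A h k \<in> L2_space T"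
  unfolding dyn_def using H1_wderiv_L2[OF T, of h] H1_state_L2[OF T, of h]
  by (intro L2_closed)

lemma misfit_L2: "x \<in> H1_space T \<Longrightarrow> misfit x \<in> L2_space T"
  by (intro L2_closed H1_state_L2 T y)

text \<open>The residual is affine in \<open>(x, w)\<close> with linear part \<open>dyn\<close>. As
  \<open>wderiv\<close> is additive only almost everywhere, the two residuals are compared through
  their norms.\<close>

lemma K_expand:
  assumes x: "x \<in> H1_space T" and h: "h \<in> H1_space T" and w: "w \<in> L2_space T" and k: "k \<in> L2_space T"
  shows "K (A, B, \<lambda>t. x t + s *\<^sub>R h t, \<lambda>t. w t + s *\<^sub>R k t)
    = K (A, B, x, w) + s * DK A B x w h k + s\<^sup>2 * QK A h k"
proof -
  note H = H1_space_scaled_add[OF T x h, of s]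
  have "L2_norm T (res A B (\<lambda>t. x t + s *\<^sub>R h t) (\<lambda>t. w t + s *\<^sub>R k t))
      = L2_norm T (\<lambda>t. res A B x w t + s *\<^sub>R dyn A h k t)"
  proof (rule L2_norm_cong_AE)
    show "AE t in lebesgue_on {0..T}. res A B (\<lambda>t. x t + s *\<^sub>R h t) (\<lambda>t. w t + s *\<^sub>R k t) t
        = res A B x w t + s *\<^sub>R dyn A h k t"
      using H(2) by eventually_elim
        (simp add: residual_def dyn_def matrix_vector_right_distrib matrix_vector_mult_scaleR algebra_simps)
  qed (intro res_L2 dyn_L2 L2_closed H(1) x h w k)+
  note r = this[THEN arg_cong, of "\<lambda>z. z\<^sup>2", unfolded L2_norm_power2_expand[OF res_L2[OF x w] dyn_L2[OF h k]]]
  have i: "(matrix_inv \<Pi>0 *v (x 0 + s *\<^sub>R h 0 - x0)) \<bullet> (x 0 + s *\<^sub>R h 0 - x0)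
      = (matrix_inv \<Pi>0 *v (x 0 - x0)) \<bullet> (x 0 - x0) + s * (2 * ((matrix_inv \<Pi>0 *v (x 0 - x0)) \<bullet> h 0))
        + s\<^sup>2 * ((matrix_inv \<Pi>0 *v h 0) \<bullet> h 0)"
    using quadratic_form_expand[OF covariance_inverse_inner_commute[OF \<Pi>0], of "x 0 - x0" s "h 0"]
    by (simp add: algebra_simps)
  note wq = L2_quadratic_form_expand[OF w k covariance_inverse_inner_commute[OF Q], of s]
  have "(\<lambda>t. C *v h t) \<in> L2_space T" by (intro L2_closed H1_state_L2 T h)
  \<comment> \<open>The state enters the misfit as \<open>- (C *v x t)\<close>, hence the step
    \<open>- s\<close>.\<close>
  from L2_quadratic_form_expand[OF misfit_L2[OF x] this covariance_inverse_inner_commute[OF R], of "- s"]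
  have m: "L2_inner T (\<lambda>t. matrix_inv R *v misfit (\<lambda>t. x t + s *\<^sub>R h t) t) (misfit (\<lambda>t. x t + s *\<^sub>R h t))
      = L2_inner T (\<lambda>t. matrix_inv R *v misfit x t) (misfit x)
        - s * (2 * L2_inner T (\<lambda>t. matrix_inv R *v misfit x t) (\<lambda>t. C *v h t))
        + s\<^sup>2 * L2_inner T (\<lambda>t. matrix_inv R *v (C *v h t)) (\<lambda>t. C *v h t)"
    by (simp add: matrix_vector_right_distrib matrix_vector_mult_scaleR diff_diff_eq)
  show ?thesis
    unfolding K_eq r i wq m DK_def QK_def by (simp add: algebra_simps)
qed

text \<open>The residual is affine in \<open>(A, B)\<close> with linear part
  \<open>- (E *v x t + F *v v t)\<close>; here \<open>x\<close> is fixed, so the identity holds at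
  every \<open>t\<close>.\<close>

lemma L_expand:
  assumes x: "x \<in> H1_space T" and w: "w \<in> L2_space T"
  shows "L (A + s *\<^sub>R E, B + s *\<^sub>R F, x, w) = L (A, B, x, w) + s * DL A B x w E F + s\<^sup>2 * QL x E F"
proof -
  have g: "(\<lambda>t. E *v x t + F *v v t) \<in> L2_space T" by (intro L2_closed H1_state_L2 T x v)
  have "res (A + s *\<^sub>R E) (B + s *\<^sub>R F) x w = (\<lambda>t. res A B x w t + (- s) *\<^sub>R (E *v x t + F *v v t))"
    by (simp add: fun_eq_iff residual_def matrix_vector_mult_add_rdistrib scaleR_matrix_vector_assoc[symmetric] algebra_simps)
  then have r: "(L2_norm T (res (A + s *\<^sub>R E) (B + s *\<^sub>R F) x w))\<^sup>2 = (L2_norm T (res A B x w))\<^sup>2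
      - s * (2 * L2_inner T (res A B x w) (\<lambda>t. E *v x t + F *v v t)) + s\<^sup>2 * (L2_norm T (\<lambda>t. E *v x t + F *v v t))\<^sup>2"
    by (simp only: L2_norm_power2_expand[OF res_L2[OF x w] g]) simp
  have A: "(norm (A + s *\<^sub>R E - A0))\<^sup>2 = (norm (A - A0))\<^sup>2 + s * (2 * ((A - A0) \<bullet> E)) + s\<^sup>2 * (norm E)\<^sup>2"
    using norm_power2_expand[of "A - A0" s E] by (simp add: algebra_simps)
  have B: "(norm (B + s *\<^sub>R F - B0))\<^sup>2 = (norm (B - B0))\<^sup>2 + s * (2 * ((B - B0) \<bullet> F)) + s\<^sup>2 * (norm F)\<^sup>2"
    using norm_power2_expand[of "B - B0" s F] by (simp add: algebra_simps)
  show ?thesis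
    unfolding L_eq r A B DL_def QL_def by (simp add: algebra_simps)
qed

text \<open>On each line through the minimizer \<open>K\<close> is a quadratic in \<open>s\<close>
  with its minimum at \<open>s = 0\<close>.\<close>

lemma K_min_stationary:
  assumes min: "is_arg_min (\<lambda>(x', w'). K (A, B, x', w')) (\<lambda>u. u \<in> H1_space T \<times> L2_space T) (x, w)"
    and h: "h \<in> H1_space T" and k: "k \<in> L2_space T"
  shows "DK A B x w h k = 0"
proof (rule quadratic_min_linear_coeff_zero)
  have xw: "x \<in> H1_space T" "w \<in> L2_space T" using min by (auto simp: is_arg_min_linorder)
  fix s
  have "(\<lambda>t. x t + s *\<^sub>R h t) \<in> H1_space T" "(\<lambda>t. w t + s *\<^sub>R k t) \<in> L2_space T"
    by (intro H1_space_scaled_add L2_closed T xw h k)+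
  then have "K (A, B, x, w) \<le> K (A, B, \<lambda>t. x t + s *\<^sub>R h t, \<lambda>t. w t + s *\<^sub>R k t)"
    using min by (auto simp: is_arg_min_linorder)
  then show "K (A, B, x, w) \<le> K (A, B, x, w) + s * DK A B x w h k + s\<^sup>2 * QK A h k"
    by (simp only: K_expand[OF xw(1) h xw(2) k])
qed

lemma L_min_stationary:
  assumes min: "is_arg_min (\<lambda>(A', B'). L (A', B', x, w)) (\<lambda>u. u \<in> UNIV) (A, B)"
    and x: "x \<in> H1_space T" and w: "w \<in> L2_space T"
  shows "DL A B x w E F = 0"
proof (rule quadratic_min_linear_coeff_zero)
  fix s
  have "L (A, B, x, w) \<le> L (A + s *\<^sub>R E, B + s *\<^sub>R F, x, w)"
    using min by (auto simp: is_arg_min_linorder)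
  then show "L (A, B, x, w) \<le> L (A, B, x, w) + s * DL A B x w E F + s\<^sup>2 * QL x E F"
    by (simp only: L_expand[OF x w])
qed

text \<open>The adjoint state is \<open>p t = \<integral>\<^sub>t\<^sup>T A\<^sup>T q - C\<^sup>T R\<^sup>-\<^sup>1 (y - C x)\<close>. Integrating by parts, stationarity in the
  state becomes \<open>(\<Pi>0\<^sup>-\<^sup>1 (x 0 - x0) + p 0) \<bullet> h 0 + \<integral> (p - q) \<bullet> h' = 0\<close> for all \<open>h\<close>,
  whence \<open>p = q\<close> almost everywhere.\<close>

lemma stationary_imp_optimality:
  assumes x: "x \<in> H1_space T" and w: "w \<in> L2_space T"
    and DK0: "\<And>h k. h \<in> H1_space T \<Longrightarrow> k \<in> L2_space T \<Longrightarrow> DK A B x w h k = 0"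
    and DL0: "\<And>E F. DL A B x w E F = 0"
  shows "optimality_conditions T \<alpha> \<beta> A0 B0 G C x0 \<Pi>0 Q R v y (A, B, x, w)"
proof -
  let ?M = "lebesgue_on {0..T}"
  define q where "q = (\<lambda>t. - \<beta> *\<^sub>R res A B x w t)"
  define z where "z = (\<lambda>t. (transpose C ** matrix_inv R) *v misfit x t)"
  define g where "g = (\<lambda>t. z t - transpose A *v q t)"
  define p where "p t = integral {0..t} g - integral {0..T} g" for t
  note xL = H1_state_L2[OF T x] and rL = res_L2[OF x w, of A B]
  have q: "q \<in> L2_space T" unfolding q_def by (intro L2_closed rL)
  have z: "z \<in> L2_space T" unfolding z_def by (intro L2_matrix misfit_L2 x)
  have g: "g \<in> L2_space T" unfolding g_def by (intro L2_closed q z)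
  have p: "H1_pair T p g"
    by (rule H1_pairI_increment[where c = "- integral {0..T} g"]) (simp_all add: g p_def)
  have pH: "p \<in> H1_space T" by (rule H1_pair_space[OF T p])
  note pL = H1_state_L2[OF T pH]
  have pT: "p T = 0" by (simp add: p_def)
  have H0: "(\<lambda>t. 0) \<in> H1_space T" by (rule H1_pair_space[OF T H1_pair_const])
  have res_q: "res A B x w t = - (1 / \<beta>) *\<^sub>R q t" for t using \<beta> by (simp add: q_def)

  have w_eq: "AE t in ?M. w t = - ((Q ** transpose G) *v q t)"
  proof -
    \<comment> \<open>The gradient in the noise; stationarity in the direction \<open>h = 0\<close>,
      \<open>k = u\<close> says that its squared norm vanishes.\<close>
    define u where "u t = transpose G *v q t + matrix_inv Q *v w t" for t
    have u: "u \<in> L2_space T" unfolding u_def by (intro L2_closed q w)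
    \<comment> \<open>Even for the zero function \<open>wderiv\<close> is a choice, known to vanish
      only almost everywhere.\<close>
    have ae0: "AE t in ?M. wderiv T (\<lambda>t. 0) t = (0 :: real^'n)"
      by (rule H1_pair_wderiv[OF T H1_pair_const])
    have "L2_inner T (res A B x w) (dyn A (\<lambda>t. 0) u) = L2_inner T (res A B x w) (\<lambda>t. - (G *v u t))"
    proof (rule L2_inner_cong_AE[OF rL rL dyn_L2[OF H0 u]])
      show "AE t in ?M. dyn A (\<lambda>t. 0) u t = - (G *v u t)"
        using ae0 by eventually_elim (simp add: dyn_def)
    qed (intro L2_uminus L2_matrix u AE_I2 refl)+
    also have "\<beta> * \<dots> = L2_inner T q (\<lambda>t. G *v u t)"
      by (simp add: q_def L2_inner_def)
    also have "\<dots> = L2_inner T (\<lambda>t. transpose G *v q t) u"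
      by (rule L2_inner_matrix_right)
    finally have "L2_inner T (\<lambda>t. transpose G *v q t) u + L2_inner T (\<lambda>t. matrix_inv Q *v w t) u = 0"
      using DK0[OF H0 u] by (simp add: DK_def L2_inner_zero_right)
    then have "L2_inner T u u = 0"
      unfolding u_def[THEN ext, of "\<lambda>t. t", simplified, symmetric]
      by (subst (1) u_def[abs_def]) (subst L2_inner_add_left; (intro L2_closed q w u)?; simp)
    then have "AE t in ?M. u t = 0"
      by (intro L2_norm_eq_0_AE u) (simp add: L2_inner_self)
    then show ?thesis
    proof eventually_elim
      case (elim t)
      then have "matrix_inv Q *v w t = - (transpose G *v q t)"
        unfolding u_def by (metis minus_unique)
      then have "w t = Q *v (- (transpose G *v q t))"
        using matrix_inv_cancel(1)[OF Q(2), of "w t"] by (simp only:)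
      then show ?case
        by (simp only: matrix_vector_mult_uminus matrix_vector_mul_assoc)
    qed
  qed

  have state: "(matrix_inv \<Pi>0 *v (x 0 - x0) + p 0) \<bullet> h 0 + L2_inner T (\<lambda>t. p t - q t) h' = 0"
    if hp: "H1_pair T h h'" for h h'
  proof -
    have h: "h \<in> H1_space T" by (rule H1_pair_space[OF T hp])
    note hL = H1_state_L2[OF T h] and h'L = H1_pair_L2[OF hp]
    have "L2_inner T (res A B x w) (dyn A h (\<lambda>t. 0)) = L2_inner T (res A B x w) (\<lambda>t. h' t - A *v h t)"
    proof (rule L2_inner_cong_AE[OF rL rL dyn_L2[OF h L2_const]])
      show "AE t in ?M. dyn A h (\<lambda>t. 0) t = h' t - A *v h t"
        using H1_pair_wderiv[OF T hp] by eventually_elim (simp add: dyn_def)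
    qed (intro L2_diff L2_matrix h'L hL AE_I2 refl)+
    also have "\<beta> * \<dots> = - L2_inner T q (\<lambda>t. h' t - A *v h t)"
      by (simp add: q_def L2_inner_def)
    also have "\<dots> = - L2_inner T q h' + L2_inner T (\<lambda>t. transpose A *v q t) h"
      unfolding L2_inner_matrix_right[symmetric] by (simp add: L2_inner_diff_right q h'L hL L2_matrix)
    finally have 1: "\<beta> * L2_inner T (res A B x w) (dyn A h (\<lambda>t. 0))
        = - L2_inner T q h' + L2_inner T (\<lambda>t. transpose A *v q t) h" .
    have 2: "L2_inner T (\<lambda>t. matrix_inv R *v misfit x t) (\<lambda>t. C *v h t) = L2_inner T z h"
      unfolding z_def matrix_vector_mul_assoc[symmetric] by (rule L2_inner_matrix_right)
    have "L2_inner T g h + L2_inner T p h' = - (p 0 \<bullet> h 0)"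
      using H1_pair_integration_by_parts[OF T bounded_bilinear_inner p hp] by (simp add: pT L2_inner_def)
    then have "L2_inner T z h - L2_inner T (\<lambda>t. transpose A *v q t) h = - (p 0 \<bullet> h 0) - L2_inner T p h'"
      unfolding g_def by (simp add: L2_inner_diff_left z q hL L2_matrix del: transpose_matrix_vector)
    then show ?thesis
      using DK0[OF h L2_const[of 0]]
      by (simp add: DK_def 1 2 L2_inner_zero_right inner_add_left L2_inner_diff_left pL q h'L)
  qed
  have pq: "AE t in ?M. p t = q t"
  proof -
    have d: "(\<lambda>t. p t - q t) \<in> L2_space T" by (intro L2_closed pL q)
    \<comment> \<open>The primitive of \<open>p - q\<close> starts at 0: as a direction it removes
      the boundary term and leaves the squared norm of \<open>p - q\<close>.\<close>
    then have "H1_pair T (\<lambda>t. integral {0..t} (\<lambda>t. p t - q t)) (\<lambda>t. p t - q t)"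
      by (rule H1_pairI_increment[where c = 0]) simp
    from state[OF this] have "L2_norm T (\<lambda>t. p t - q t) = 0"
      by (simp add: L2_inner_self)
    from L2_norm_eq_0_AE[OF d this] show ?thesis by simp
  qed
  have x_init: "x 0 = x0 - \<Pi>0 *v p 0"
  proof -
    have "matrix_inv \<Pi>0 *v (x 0 - x0) + p 0 = 0"
      \<comment> \<open>A constant direction has derivative zero; taking the coefficient itself as
        the constant leaves its squared norm.\<close>
      using state[OF H1_pair_const[of T "matrix_inv \<Pi>0 *v (x 0 - x0) + p 0"]]
      by (simp add: L2_inner_zero_right)
    then have "\<Pi>0 *v (matrix_inv \<Pi>0 *v (x 0 - x0)) = \<Pi>0 *v (- p 0)"
      by (intro arg_cong[where f = "(*v) \<Pi>0"]) (rule eq_neg_iff_add_eq_0[THEN iffD2])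
    then have "x 0 - x0 = - (\<Pi>0 *v p 0)"
      by (simp add: matrix_inv_cancel[OF \<Pi>0(2)] matrix_vector_mult_uminus)
    then show ?thesis by (simp add: algebra_simps)
  qed

  have outer_cong: "(LINT t|?M. outer_product (p t) (u t)) = (LINT t|?M. outer_product (q t) (u t))"
    if "u \<in> L2_space T" for u :: "real \<Rightarrow> real^'k"
    using pq that pL q
    by (intro integral_cong_AE borel_measurable_integrable L2_bilinear_integrable[OF bounded_bilinear_outer_product]) auto
  \<comment> \<open>The left side is the gradient of \<open>L\<close> with respect to
    \<open>A\<close>; stationarity in its own direction gives \<open>?S \<bullet> ?S = 0\<close>.
    The equation for \<open>B\<close> is obtained in the same way.\<close>
  have A_eq: "\<alpha> *\<^sub>R (A - A0) + (LINT t|?M. outer_product (p t) (x t)) = 0" (is "?S = 0")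
  proof -
    have "?S \<bullet> ?S = \<alpha> * ((A - A0) \<bullet> ?S) + L2_inner T q (\<lambda>t. ?S *v x t)"
      unfolding outer_cong[OF xL]
      by (subst inner_add_left) (simp only: integral_outer_product_inner[OF q xL, symmetric] inner_commute[of _ "LINT t|?M. _ t"] inner_scaleR_left)
    also have "L2_inner T q (\<lambda>t. ?S *v x t) = - \<beta> * L2_inner T (res A B x w) (\<lambda>t. ?S *v x t)"
      by (simp add: q_def L2_inner_def)
    finally have "?S \<bullet> ?S = DL A B x w ?S 0" by (simp add: DL_def)
    then show ?thesis using DL0 by simp
  qed
  have B_eq: "\<alpha> *\<^sub>R (B - B0) + (LINT t|?M. outer_product (p t) (v t)) = 0" (is "?S = 0")
  proof -
    have "?S \<bullet> ?S = \<alpha> * ((B - B0) \<bullet> ?S) + L2_inner T q (\<lambda>t. ?S *v v t)"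
      unfolding outer_cong[OF v]
      by (subst inner_add_left) (simp only: integral_outer_product_inner[OF q v, symmetric] inner_commute[of _ "LINT t|?M. _ t"] inner_scaleR_left)
    also have "L2_inner T q (\<lambda>t. ?S *v v t) = - \<beta> * L2_inner T (res A B x w) (\<lambda>t. ?S *v v t)"
      by (simp add: q_def L2_inner_def)
    finally have "?S \<bullet> ?S = DL A B x w 0 ?S" by (simp add: DL_def)
    then show ?thesis using DL0 by simp
  qed

  have c1: "AE t in ?M. p t = - \<beta> *\<^sub>R (wderiv T x t - A *v x t - B *v v t - G *v w t)"
    using pq by (simp add: q_def residual_def)
  have c2: "AE t in ?M. wderiv T x t = A *v x t + B *v v t - (G ** Q ** transpose G + (1 / \<beta>) *\<^sub>R mat 1) *v p t"
    using pq w_eq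
  proof eventually_elim
    case (elim t)
    have "wderiv T x t = A *v x t + B *v v t + G *v w t + res A B x w t"
      by (simp add: residual_def)
    also have "G *v w t = - ((G ** Q ** transpose G) *v p t)"
      using elim by (simp only: matrix_vector_mult_uminus matrix_vector_mul_assoc matrix_mul_assoc)
    finally show ?case
      using elim(1) by (simp add: res_q matrix_vector_mult_add_rdistrib scaleR_matrix_vector_assoc[symmetric])
  qed
  have c3: "AE t in ?M. - wderiv T p t = transpose A *v p t - (transpose C ** matrix_inv R) *v (y t - C *v x t)"
    using pq H1_pair_wderiv[OF T p] by eventually_elim (simp add: g_def z_def)
  have c4: "AE t in ?M. w t = - ((Q ** transpose G) *v p t)"
    using pq w_eq by eventually_elim simp
  \<comment> \<open>The adjoint state of the optimality conditions is \<open>p\<close>, the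
    continuous representative of \<open>q\<close>, so that its values at 0 and \<open>T\<close> make
    sense.\<close>
  show ?thesis
    unfolding optimality_conditions_def
    using pH c1 c2 x_init c3 pT A_eq B_eq c4 by auto
qed

section \<open>Coercivity of the functionals\<close>

lemma quad_nonneg:
  "0 \<le> (matrix_inv \<Pi>0 *v a) \<bullet> a" "0 \<le> L2_inner T (\<lambda>t. matrix_inv Q *v k t) k"
  "0 \<le> L2_inner T (\<lambda>t. matrix_inv R *v f t) f"
proof -
  have *: "0 \<le> (matrix_inv P *v a) \<bullet> a" if P: "covariance_matrix P" "invertible P" for P :: "real^'k^'k" and a
  proof -
    obtain c where "c > 0" "c * (norm a)\<^sup>2 \<le> (matrix_inv P *v a) \<bullet> a"
      using covariance_inverse_coercive[OF P] by metis
    then show ?thesis by (meson mult_nonneg_nonneg less_imp_le order_trans zero_le_power2)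
  qed
  show "0 \<le> (matrix_inv \<Pi>0 *v a) \<bullet> a" by (rule *[OF \<Pi>0])
  show "0 \<le> L2_inner T (\<lambda>t. matrix_inv Q *v k t) k" "0 \<le> L2_inner T (\<lambda>t. matrix_inv R *v f t) f"
    unfolding L2_inner_def by (intro Bochner_Integration.integral_nonneg *[OF Q] *[OF R])+
qed

lemma Q_coercive:
  obtains c where "c > 0" "\<And>k. k \<in> L2_space T \<Longrightarrow> c * (L2_norm T k)\<^sup>2 \<le> L2_inner T (\<lambda>t. matrix_inv Q *v k t) k"
proof -
  obtain c where c: "c > 0" "\<And>u. c * (norm u)\<^sup>2 \<le> (matrix_inv Q *v u) \<bullet> u"
    using covariance_inverse_coercive[OF Q] by metis
  have "c * (L2_norm T k)\<^sup>2 \<le> L2_inner T (\<lambda>t. matrix_inv Q *v k t) k" if k: "k \<in> L2_space T" for k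
  proof -
    have "c * (L2_norm T k)\<^sup>2 = (LINT t|lebesgue_on {0..T}. c * (norm (k t))\<^sup>2)"
      by (simp add: L2_norm_power2)
    also have "\<dots> \<le> L2_inner T (\<lambda>t. matrix_inv Q *v k t) k"
      unfolding L2_inner_def
      by (intro integral_mono c integrable_mult_right L2_integrable_power2 L2_inner_integrable L2_matrix k)
    finally show ?thesis .
  qed
  with c(1) show ?thesis by (rule that)
qed

text \<open>Moving the noise term into the forcing turns a bound on \<open>dyn\<close> into one on
  the derivative, with a factor that depends on \<open>M\<close> only through
  \<open>a\<close>.\<close>

lemma wderiv_bound:
  assumes "0 < a" "norm M \<le> a" and h: "h \<in> H1_space T" and k: "k \<in> L2_space T"
  shows "L2_norm T (wderiv T h)
    \<le> energy_const T a * (norm (h 0) + (L2_norm T (dyn M h k) + norm G * L2_norm T k))"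
proof -
  have "L2_norm T (\<lambda>t. wderiv T h t - M *v h t) \<le> L2_norm T (dyn M h k) + norm G * L2_norm T k"
  proof -
    have "(\<lambda>t. wderiv T h t - M *v h t) = (\<lambda>t. dyn M h k t + G *v k t)" by (simp add: dyn_def)
    then show ?thesis
      using L2_norm_triangle[OF dyn_L2[OF h k] L2_matrix[OF k, of G], of M] L2_norm_matrix[OF k, of G] by simp
  qed
  moreover have "0 \<le> energy_const T a" using assms(1) T by (simp add: energy_const_def)
  ultimately show ?thesis
    by (intro order_trans[OF H1_energy[OF T assms(1,2) h]] mult_left_mono) auto
qed

text \<open>Each squared quantity is, up to a factor, a summand of the functional or is dominated by
  one through coercivity of an inverse covariance, and the other summands are nonnegative. Since
  \<open>c\<close> does not depend on the iterate, the bounds are uniform along the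
  iteration.\<close>

lemma J_components:
  obtains c where "c > 0"
    "\<And>A B x w. x \<in> H1_space T \<Longrightarrow> w \<in> L2_space T \<Longrightarrow>
      c * (norm (A - A0))\<^sup>2 \<le> J (A, B, x, w) \<and> c * (norm (B - B0))\<^sup>2 \<le> J (A, B, x, w) \<and>
      c * (norm (x 0 - x0))\<^sup>2 \<le> J (A, B, x, w) \<and> c * (L2_norm T w)\<^sup>2 \<le> J (A, B, x, w) \<and>
      c * (L2_norm T (res A B x w))\<^sup>2 \<le> J (A, B, x, w)"
    "\<And>h k A. h \<in> H1_space T \<Longrightarrow> k \<in> L2_space T \<Longrightarrow>
      c * (norm (h 0))\<^sup>2 \<le> QK A h k \<and> c * (L2_norm T k)\<^sup>2 \<le> QK A h k \<and>
      c * (L2_norm T (dyn A h k))\<^sup>2 \<le> QK A h k"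
    "\<And>x E F. c * (norm E)\<^sup>2 \<le> QL x E F \<and> c * (norm F)\<^sup>2 \<le> QL x E F"
proof -
  obtain c1 where c1: "c1 > 0" "\<And>u. c1 * (norm u)\<^sup>2 \<le> (matrix_inv \<Pi>0 *v u) \<bullet> u"
    using covariance_inverse_coercive[OF \<Pi>0] by metis
  obtain c2 where c2: "c2 > 0" "\<And>k. k \<in> L2_space T \<Longrightarrow> c2 * (L2_norm T k)\<^sup>2 \<le> L2_inner T (\<lambda>t. matrix_inv Q *v k t) k"
    using Q_coercive by metis
  define c where "c = min (min c1 c2) (min \<alpha> \<beta>) / 2"
  have c: "c > 0" using c1(1) c2(1) \<alpha> \<beta> by (simp add: c_def)
  have le: "c * z\<^sup>2 \<le> c1 / 2 * z\<^sup>2" "c * z\<^sup>2 \<le> c2 / 2 * z\<^sup>2" "c * z\<^sup>2 \<le> \<alpha> / 2 * z\<^sup>2" "c * z\<^sup>2 \<le> \<beta> / 2 * z\<^sup>2" for z :: real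
    by (intro mult_right_mono; simp add: c_def)+
  have pos: "0 \<le> \<alpha> / 2 * z\<^sup>2" "0 \<le> \<beta> / 2 * z\<^sup>2" for z :: real using \<alpha> \<beta> by simp_all
  show ?thesis
  proof (rule that[OF c])
    fix A :: "real^'n^'n" and B :: "real^'d^'n" and x :: "real \<Rightarrow> real^'n" and w :: "real \<Rightarrow> real^'m"
    assume "x \<in> H1_space T" "w \<in> L2_space T"
    then show "c * (norm (A - A0))\<^sup>2 \<le> J (A, B, x, w) \<and> c * (norm (B - B0))\<^sup>2 \<le> J (A, B, x, w) \<and>
      c * (norm (x 0 - x0))\<^sup>2 \<le> J (A, B, x, w) \<and> c * (L2_norm T w)\<^sup>2 \<le> J (A, B, x, w) \<and>
      c * (L2_norm T (res A B x w))\<^sup>2 \<le> J (A, B, x, w)"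
      using le[of "norm (A - A0)"] le[of "norm (B - B0)"] le[of "norm (x 0 - x0)"] le[of "L2_norm T w"]
        le[of "L2_norm T (res A B x w)"] pos(1)[of "norm (A - A0)"] pos(1)[of "norm (B - B0)"]
        pos(2)[of "L2_norm T (res A B x w)"] quad_nonneg(1)[of "x 0 - x0"] quad_nonneg(2)[of w]
        quad_nonneg(3)[of "misfit x"] c1(2)[of "x 0 - x0"] c2(2)[of w]
      unfolding J_eq_K K_eq distrib_left by linarith
  next
    fix h :: "real \<Rightarrow> real^'n" and k :: "real \<Rightarrow> real^'m" and A :: "real^'n^'n"
    assume "h \<in> H1_space T" "k \<in> L2_space T"
    then show "c * (norm (h 0))\<^sup>2 \<le> QK A h k \<and> c * (L2_norm T k)\<^sup>2 \<le> QK A h k \<and>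
      c * (L2_norm T (dyn A h k))\<^sup>2 \<le> QK A h k"
      using le[of "norm (h 0)"] le[of "L2_norm T k"] le[of "L2_norm T (dyn A h k)"]
        pos(2)[of "L2_norm T (dyn A h k)"] quad_nonneg(1)[of "h 0"] quad_nonneg(2)[of k]
        quad_nonneg(3)[of "\<lambda>t. C *v h t"] c1(2)[of "h 0"] c2(2)[of k]
      unfolding QK_def by linarith
  next
    fix x :: "real \<Rightarrow> real^'n" and E :: "real^'n^'n" and F :: "real^'d^'n"
    show "c * (norm E)\<^sup>2 \<le> QL x E F \<and> c * (norm F)\<^sup>2 \<le> QL x E F"
      using le[of "norm E"] le[of "norm F"] pos(1)[of "norm E"] pos(1)[of "norm F"]
        pos(2)[of "L2_norm T (\<lambda>t. E *v x t + F *v v t)"]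
      unfolding QL_def distrib_left by linarith
  qed
qed

end

section \<open>Alternating minimization\<close>

locale alternating_minimization = assimilation T \<alpha> \<beta> A0 B0 G C x0 \<Pi>0 Q R v y
  for T \<alpha> \<beta> :: real
    and A0 :: "real^'n^'n" and B0 :: "real^'d^'n" and G :: "real^'m^'n" and C :: "real^'n^'p"
    and x0 :: "real^'n" and \<Pi>0 :: "real^'n^'n" and Q :: "real^'m^'m" and R :: "real^'p^'p"
    and v :: "real \<Rightarrow> real^'d" and y :: "real \<Rightarrow> real^'p" +
  fixes A :: "nat \<Rightarrow> real^'n^'n" and B :: "nat \<Rightarrow> real^'d^'n"
    and x :: "nat \<Rightarrow> real \<Rightarrow> real^'n" and w :: "nat \<Rightarrow> real \<Rightarrow> real^'m"
  assumes min_xw: "\<And>n. is_arg_min (\<lambda>(x', w'). K (A n, B n, x', w'))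
      (\<lambda>u. u \<in> H1_space T \<times> L2_space T) (x n, w n)"
    and min_AB: "\<And>n. is_arg_min (\<lambda>(A', B'). L (A', B', x n, w n)) (\<lambda>u. u \<in> UNIV) (A (Suc n), B (Suc n))"
begin

lemma iterate_spaces: "x n \<in> H1_space T" "w n \<in> L2_space T"
  using min_xw[of n] by (auto simp: is_arg_min_linorder)

definition cost :: "nat \<Rightarrow> real" where "cost n = J (A n, B n, x n, w n)"
definition dx :: "nat \<Rightarrow> real \<Rightarrow> real^'n" where "dx n = (\<lambda>t. x (Suc n) t - x n t)"
definition dw :: "nat \<Rightarrow> real \<Rightarrow> real^'m" where "dw n = (\<lambda>t. w (Suc n) t - w n t)"

lemma increment_spaces: "dx n \<in> H1_space T" "dw n \<in> L2_space T"
  unfolding dx_def dw_def by (intro H1_space_diff L2_diff T iterate_spaces)+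

text \<open>The value between the two half steps is
  \<open>J (A (Suc n), B (Suc n), x n, w n)\<close>. Each half step is expanded backwards, around
  its new minimizer, where the linear term vanishes; \<open>s = - 1\<close> leads back to the old
  iterate.\<close>

lemma cost_decrement:
  "cost n - cost (Suc n) = QL (x n) (A (Suc n) - A n) (B (Suc n) - B n) + QK (A (Suc n)) (dx n) (dw n)"
proof -
  have "L (A n, B n, x n, w n) = L (A (Suc n) + (- 1) *\<^sub>R (A (Suc n) - A n), B (Suc n) + (- 1) *\<^sub>R (B (Suc n) - B n), x n, w n)"
    by simp
  also have "\<dots> = L (A (Suc n), B (Suc n), x n, w n) + QL (x n) (A (Suc n) - A n) (B (Suc n) - B n)"
    by (simp only: L_expand iterate_spaces L_min_stationary[OF min_AB]) simp
  finally have "cost n = J (A (Suc n), B (Suc n), x n, w n) + QL (x n) (A (Suc n) - A n) (B (Suc n) - B n)"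
    by (simp add: cost_def J_eq_L)
  moreover have "K (A (Suc n), B (Suc n), x n, w n)
      = K (A (Suc n), B (Suc n), \<lambda>t. x (Suc n) t + (- 1) *\<^sub>R dx n t, \<lambda>t. w (Suc n) t + (- 1) *\<^sub>R dw n t)"
    by (simp add: dx_def dw_def)
  then have "K (A (Suc n), B (Suc n), x n, w n)
      = K (A (Suc n), B (Suc n), x (Suc n), w (Suc n)) + QK (A (Suc n)) (dx n) (dw n)"
    by (simp only: K_expand iterate_spaces increment_spaces K_min_stationary[OF min_xw]) simp
  then have "J (A (Suc n), B (Suc n), x n, w n) = cost (Suc n) + QK (A (Suc n)) (dx n) (dw n)"
    by (simp add: cost_def J_eq_K)
  ultimately show ?thesis by simp
qed

lemma decrement_nonneg:
  "0 \<le> QL (x n) (A (Suc n) - A n) (B (Suc n) - B n)" "0 \<le> QK (A (Suc n)) (dx n) (dw n)"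
proof -
  obtain c where c: "c > 0"
    "\<And>h k A. h \<in> H1_space T \<Longrightarrow> k \<in> L2_space T \<Longrightarrow> c * (norm (h 0))\<^sup>2 \<le> QK A h k"
    "\<And>x E F. c * (norm E)\<^sup>2 \<le> QL x E F"
    by (rule J_components) metis
  have "0 \<le> c * z\<^sup>2" for z using c(1) by simp
  then show "0 \<le> QL (x n) (A (Suc n) - A n) (B (Suc n) - B n)" "0 \<le> QK (A (Suc n)) (dx n) (dw n)"
    using c(2)[OF increment_spaces] c(3) order_trans by blast+
qed

lemma cost_decreasing: "cost (Suc n) \<le> cost n"
  using cost_decrement[of n] decrement_nonneg[of n] by linarith

lemma decrements_tendsto_0:
  "(\<lambda>n. QL (x n) (A (Suc n) - A n) (B (Suc n) - B n)) \<longlonglongrightarrow> 0"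
  "(\<lambda>n. QK (A (Suc n)) (dx n) (dw n)) \<longlonglongrightarrow> 0"
proof -
  obtain c where c: "c > 0"
    "\<And>A B x w. x \<in> H1_space T \<Longrightarrow> w \<in> L2_space T \<Longrightarrow> c * (norm (A - A0))\<^sup>2 \<le> J (A, B, x, w)"
    by (rule J_components) metis
  have "0 \<le> c * z\<^sup>2" for z using c(1) by simp
  then have "0 \<le> cost n" for n
    unfolding cost_def using c(2)[OF iterate_spaces] order_trans by blast
  then obtain l where l: "cost \<longlonglongrightarrow> l"
    using decseq_convergent[of cost 0] cost_decreasing by (metis decseq_Suc_iff)
  have "(\<lambda>n. cost n - cost (Suc n)) \<longlonglongrightarrow> l - l"
    by (intro tendsto_diff l LIMSEQ_Suc)
  then have d: "(\<lambda>n. cost n - cost (Suc n)) \<longlonglongrightarrow> 0" by simp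
  show "(\<lambda>n. QL (x n) (A (Suc n) - A n) (B (Suc n) - B n)) \<longlonglongrightarrow> 0"
    by (rule tendsto_0_le[OF d]) (use decrement_nonneg in \<open>simp_all add: cost_decrement\<close>)
  show "(\<lambda>n. QK (A (Suc n)) (dx n) (dw n)) \<longlonglongrightarrow> 0"
    by (rule tendsto_0_le[OF d]) (use decrement_nonneg in \<open>simp_all add: cost_decrement\<close>)
qed

lemma iterates_bounded:
  obtains M where "M > 0"
    "\<And>n. norm (A n) \<le> M \<and> norm (B n) \<le> M \<and> norm (x n 0) \<le> M \<and> L2_norm T (w n) \<le> M \<and>
      L2_norm T (res (A n) (B n) (x n) (w n)) \<le> M"
proof -
  obtain c where c: "c > 0"
    "\<And>A B x w. x \<in> H1_space T \<Longrightarrow> w \<in> L2_space T \<Longrightarrow>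
      c * (norm (A - A0))\<^sup>2 \<le> J (A, B, x, w) \<and> c * (norm (B - B0))\<^sup>2 \<le> J (A, B, x, w) \<and>
      c * (norm (x 0 - x0))\<^sup>2 \<le> J (A, B, x, w) \<and> c * (L2_norm T w)\<^sup>2 \<le> J (A, B, x, w) \<and>
      c * (L2_norm T (res A B x w))\<^sup>2 \<le> J (A, B, x, w)"
    by (rule J_components) metis
  have "decseq cost" by (simp add: decseq_Suc_iff cost_decreasing)
  then have "cost n \<le> cost 0" for n by (simp add: decseqD)
  then have *: "z \<le> sqrt (cost 0 / c)" if "c * z\<^sup>2 \<le> cost n" for z n
    using le_sqrt_of_square_le[OF c(1) order_trans[OF that]] by blast
  define b where "b = sqrt (cost 0 / c)"
  have b: "norm (A n - A0) \<le> b" "norm (B n - B0) \<le> b" "norm (x n 0 - x0) \<le> b" "L2_norm T (w n) \<le> b"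
      "L2_norm T (res (A n) (B n) (x n) (w n)) \<le> b" for n
    using c(2)[OF iterate_spaces(1)[of n] iterate_spaces(2)[of n], of "A n" "B n"]
    unfolding b_def cost_def[of n, symmetric] by (auto intro!: *)
  define M where "M = b + norm A0 + norm B0 + norm x0 + 1"
  have "0 \<le> b" using b(4)[of 0] L2_norm_nonneg[of T "w 0"] by linarith
  then have M: "b \<le> M" "b + norm A0 \<le> M" "b + norm B0 \<le> M" "b + norm x0 \<le> M" "0 < M"
    unfolding M_def using norm_ge_zero[of A0] norm_ge_zero[of B0] norm_ge_zero[of x0] by linarith+
  show ?thesis
  proof (rule that[OF M(5)], intro conjI)
    fix n
    show "norm (A n) \<le> M" using norm_triangle_sub[of "A n" A0] b(1)[of n] M by linarith
    show "norm (B n) \<le> M" using norm_triangle_sub[of "B n" B0] b(2)[of n] M by linarith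
    show "norm (x n 0) \<le> M" using norm_triangle_sub[of "x n 0" x0] b(3)[of n] M by linarith
    show "L2_norm T (w n) \<le> M" "L2_norm T (res (A n) (B n) (x n) (w n)) \<le> M" using b(4,5)[of n] M by linarith+
  qed
qed

text \<open>The cost bounds the residual, which still contains the input \<open>B n *v v t\<close>;
  adding this term back gives \<open>dyn\<close>, from which the energy estimate recovers the
  derivative.\<close>

lemma Z_norm_bounded: "\<exists>M. \<forall>n. Z_norm T (A n, B n, x n, w n) \<le> M"
proof -
  obtain M where M: "M > 0"
    "\<And>n. norm (A n) \<le> M \<and> norm (B n) \<le> M \<and> norm (x n 0) \<le> M \<and> L2_norm T (w n) \<le> M \<and>
      L2_norm T (res (A n) (B n) (x n) (w n)) \<le> M"
    using iterates_bounded by metis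
  define D where "D = energy_const T M * (M + ((M + M * L2_norm T v) + norm G * M))"
  have e: "0 \<le> energy_const T M" using M(1) T by (simp add: energy_const_def)
  have "L2_norm T (wderiv T (x n)) \<le> D" for n
  proof -
    have "dyn (A n) (x n) (w n) = (\<lambda>t. res (A n) (B n) (x n) (w n) t + B n *v v t)"
      by (simp add: dyn_def residual_def fun_eq_iff)
    then have "L2_norm T (dyn (A n) (x n) (w n)) \<le> L2_norm T (res (A n) (B n) (x n) (w n)) + norm (B n) * L2_norm T v"
      using L2_norm_triangle[OF res_L2[OF iterate_spaces] L2_matrix[OF v, of "B n"], of "A n" "B n" n n]
        L2_norm_matrix[OF v, of "B n"] by simp
    also have "\<dots> \<le> M + M * L2_norm T v"
      using M(2)[of n] by (intro add_mono mult_right_mono) (auto simp: L2_norm_nonneg)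
    finally have "energy_const T M * (norm (x n 0) + (L2_norm T (dyn (A n) (x n) (w n)) + norm G * L2_norm T (w n))) \<le> D"
      unfolding D_def using M(2)[of n] e by (intro mult_left_mono add_mono) auto
    with wderiv_bound[OF M(1) _ iterate_spaces, of "A n" n n] M(2)[of n] show ?thesis by simp
  qed
  then have "Z_norm T (A n, B n, x n, w n) \<le> M + M + M + D + M" for n
    using M(2)[of n] by (intro order_trans[OF Z_norm_le] add_mono) auto
  then show ?thesis by blast
qed

text \<open>The decrement controls \<open>dyn (A (Suc n)) (dx n) (dw n)\<close>, whose matrix varies
  with \<open>n\<close>. A common bound \<open>M\<close> for all the matrices keeps the energy
  constant fixed while \<open>n\<close> grows.\<close>

lemma increments_tendsto_0:
  "(\<lambda>n. norm (A (Suc n) - A n)) \<longlonglongrightarrow> 0" "(\<lambda>n. norm (B (Suc n) - B n)) \<longlonglongrightarrow> 0"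
  "(\<lambda>n. norm (dx n 0)) \<longlonglongrightarrow> 0" "(\<lambda>n. L2_norm T (dw n)) \<longlonglongrightarrow> 0"
  "(\<lambda>n. L2_norm T (wderiv T (dx n))) \<longlonglongrightarrow> 0"
proof -
  obtain c where c: "c > 0"
    "\<And>h k A. h \<in> H1_space T \<Longrightarrow> k \<in> L2_space T \<Longrightarrow>
      c * (norm (h 0))\<^sup>2 \<le> QK A h k \<and> c * (L2_norm T k)\<^sup>2 \<le> QK A h k \<and>
      c * (L2_norm T (dyn A h k))\<^sup>2 \<le> QK A h k"
    "\<And>x E F. c * (norm E)\<^sup>2 \<le> QL x E F \<and> c * (norm F)\<^sup>2 \<le> QL x E F"
    by (rule J_components) metis
  obtain M where M: "M > 0" "\<And>n. norm (A n) \<le> M" using iterates_bounded by metis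
  note lim = tendsto_0_of_square_le[OF c(1)]
  show "(\<lambda>n. norm (A (Suc n) - A n)) \<longlonglongrightarrow> 0" "(\<lambda>n. norm (B (Suc n) - B n)) \<longlonglongrightarrow> 0"
    by (rule lim[OF _ _ decrements_tendsto_0(1)]; use c(3) in simp)+
  note q = c(2)[OF increment_spaces]
  show d0: "(\<lambda>n. norm (dx n 0)) \<longlonglongrightarrow> 0" and dw: "(\<lambda>n. L2_norm T (dw n)) \<longlonglongrightarrow> 0"
    by (rule lim[OF _ _ decrements_tendsto_0(2)]; use q in \<open>simp add: L2_norm_nonneg\<close>)+
  have dd: "(\<lambda>n. L2_norm T (dyn (A (Suc n)) (dx n) (dw n))) \<longlonglongrightarrow> 0"
    by (rule lim[OF _ _ decrements_tendsto_0(2)]; use q in \<open>simp add: L2_norm_nonneg\<close>)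
  show "(\<lambda>n. L2_norm T (wderiv T (dx n))) \<longlonglongrightarrow> 0"
  proof (rule tendsto_0_le[OF _ L2_norm_nonneg])
    have "(\<lambda>n. energy_const T M * (norm (dx n 0) + (L2_norm T (dyn (A (Suc n)) (dx n) (dw n)) + norm G * L2_norm T (dw n))))
      \<longlonglongrightarrow> energy_const T M * (0 + (0 + norm G * 0))"
      by (intro tendsto_intros d0 dd dw)
    then show "(\<lambda>n. energy_const T M * (norm (dx n 0) + (L2_norm T (dyn (A (Suc n)) (dx n) (dw n)) + norm G * L2_norm T (dw n))))
      \<longlonglongrightarrow> 0" by simp
    show "L2_norm T (wderiv T (dx n)) \<le> energy_const T M * (norm (dx n 0) + (L2_norm T (dyn (A (Suc n)) (dx n) (dw n)) + norm G * L2_norm T (dw n)))" for n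
      by (rule wderiv_bound[OF M increment_spaces])
  qed
qed

lemma Z_norm_increment_tendsto_0:
  "(\<lambda>n. Z_norm T (A (Suc n) - A n, B (Suc n) - B n, dx n, dw n)) \<longlonglongrightarrow> 0"
proof (rule tendsto_0_le[OF _ _ Z_norm_le])
  show "(\<lambda>n. norm (A (Suc n) - A n) + norm (B (Suc n) - B n) + norm (dx n 0) + L2_norm T (wderiv T (dx n)) + L2_norm T (dw n)) \<longlonglongrightarrow> 0"
    using tendsto_add[OF tendsto_add[OF tendsto_add[OF tendsto_add[OF increments_tendsto_0(1,2)]
        increments_tendsto_0(3)] increments_tendsto_0(5)] increments_tendsto_0(4)] by simp
qed (simp add: Z_norm_eq)

section \<open>Passage to the limit along a subsequence\<close>

lemma limit_optimality:
  assumes Zh: "x' \<in> H1_space T" "w' \<in> L2_space T" and r: "strict_mono r"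
    and lim: "(\<lambda>k. Z_norm T (A (r k) - A', B (r k) - B', \<lambda>t. x (r k) t - x' t, \<lambda>t. w (r k) t - w' t)) \<longlonglongrightarrow> 0"
  shows "optimality_conditions T \<alpha> \<beta> A0 B0 G C x0 \<Pi>0 Q R v y (A', B', x', w')"
proof (rule stationary_imp_optimality[OF Zh])
  let ?h = "\<lambda>k t. x (r k) t - x' t"
  have comp: "(\<lambda>k. norm (A (r k) - A')) \<longlonglongrightarrow> 0" "(\<lambda>k. norm (B (r k) - B')) \<longlonglongrightarrow> 0"
    "(\<lambda>k. norm (?h k 0)) \<longlonglongrightarrow> 0" "(\<lambda>k. L2_norm T (wderiv T (?h k))) \<longlonglongrightarrow> 0"
    "(\<lambda>k. L2_norm T (\<lambda>t. w (r k) t - w' t)) \<longlonglongrightarrow> 0"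
    by (rule tendsto_0_le[OF lim _ Z_norm_components(1)] tendsto_0_le[OF lim _ Z_norm_components(2)]
        tendsto_0_le[OF lim _ Z_norm_components(3)[where h = "?h _"]] tendsto_0_le[OF lim _ Z_norm_components(4)]
        tendsto_0_le[OF lim _ Z_norm_components(5)]; simp add: L2_norm_nonneg)+
  have A: "(\<lambda>k. A (r k)) \<longlonglongrightarrow> A'" and B: "(\<lambda>k. B (r k)) \<longlonglongrightarrow> B'" and xi: "(\<lambda>k. x (r k) 0) \<longlonglongrightarrow> x' 0"
    using comp(1-3) by (auto intro: LIM_zero_cancel tendsto_norm_zero_cancel)
  \<comment> \<open>The pair that is stationary for \<open>L\<close> at \<open>(x n, w n)\<close>
    carries the index \<open>Suc n\<close>; vanishing increments give the shifted subsequences the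
    same limits.\<close>
  have A1: "(\<lambda>k. A (Suc (r k))) \<longlonglongrightarrow> A'" and B1: "(\<lambda>k. B (Suc (r k))) \<longlonglongrightarrow> B'"
  proof -
    have "(\<lambda>k. A (Suc (r k)) - A (r k)) \<longlonglongrightarrow> 0" "(\<lambda>k. B (Suc (r k)) - B (r k)) \<longlonglongrightarrow> 0"
      using LIMSEQ_subseq_LIMSEQ[OF increments_tendsto_0(1) r] LIMSEQ_subseq_LIMSEQ[OF increments_tendsto_0(2) r]
      by (auto simp: o_def intro: tendsto_norm_zero_cancel)
    from tendsto_add[OF this(1) A] tendsto_add[OF this(2) B]
    show "(\<lambda>k. A (Suc (r k))) \<longlonglongrightarrow> A'" "(\<lambda>k. B (Suc (r k))) \<longlonglongrightarrow> B'" by simp_all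
  qed
  have h: "?h k \<in> H1_space T" for k by (intro H1_space_diff T iterate_spaces Zh)
  have xl: "L2_lim T (\<lambda>k. x (r k)) x'"
  proof (rule L2_limI)
    have "(\<lambda>k. sqrt T * (norm (?h k 0) + sqrt T * L2_norm T (wderiv T (?h k)))) \<longlonglongrightarrow> sqrt T * (0 + sqrt T * 0)"
      by (intro tendsto_intros comp)
    then show "(\<lambda>k. sqrt T * (norm (?h k 0) + sqrt T * L2_norm T (wderiv T (?h k)))) \<longlonglongrightarrow> 0" by simp
    show "L2_norm T (?h k) \<le> sqrt T * (norm (?h k 0) + sqrt T * L2_norm T (wderiv T (?h k)))" for k
      by (rule H1_norm_bound[OF T h])
  qed (intro H1_state_L2 T iterate_spaces Zh)+
  have dl: "L2_lim T (\<lambda>k. wderiv T (x (r k))) (wderiv T x')"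
  proof (rule L2_limI[OF _ _ comp(4)])
    fix k
    have "L2_norm T (\<lambda>t. wderiv T (x (r k)) t - wderiv T x' t) = L2_norm T (wderiv T (?h k))"
      using H1_space_diff(2)[OF T iterate_spaces(1)[of "r k"] Zh(1)]
      by (intro L2_norm_cong_AE L2_diff H1_wderiv_L2 T iterate_spaces Zh h) (auto elim: eventually_mono)
    then show "L2_norm T (\<lambda>t. wderiv T (x (r k)) t - wderiv T x' t) \<le> L2_norm T (wderiv T (?h k))" by simp
  qed (intro H1_wderiv_L2 T iterate_spaces Zh)+
  have wl: "L2_lim T (\<lambda>k. w (r k)) w'"
    using comp(5) by (simp add: L2_lim_def iterate_spaces Zh)
  have resl: "L2_lim T (\<lambda>k. res (E k) (F k) (x (r k)) (w (r k))) (res A' B' x' w')"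
    if "E \<longlonglongrightarrow> A'" "F \<longlonglongrightarrow> B'" for E F
    unfolding residual_def prod.case
    by (intro L2_lim_diff L2_lim_matrix dl xl wl that tendsto_const L2_lim_const v)
  show "DK A' B' x' w' h' k' = 0"
    if h': "h' \<in> H1_space T" and k': "k' \<in> L2_space T" for h' k'
  proof -
    have hL: "h' \<in> L2_space T" by (rule H1_state_L2[OF T h'])
    have dynl: "L2_lim T (\<lambda>k. dyn (A (r k)) h' k') (dyn A' h' k')"
      unfolding dyn_def
      by (intro L2_lim_diff L2_lim_matrix A tendsto_const L2_lim_const H1_wderiv_L2[OF T h'] hL k')
    have "(\<lambda>k. DK (A (r k)) (B (r k)) (x (r k)) (w (r k)) h' k') \<longlonglongrightarrow> DK A' B' x' w' h' k'"
      unfolding DK_def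
      by (intro tendsto_intros bounded_linear.tendsto[OF matrix_vector_mul_bounded_linear] xi
          L2_lim_inner resl[OF A B] dynl L2_lim_matrix L2_lim_diff wl xl L2_lim_const k' y hL L2_matrix)
    then show ?thesis
      by (simp add: K_min_stationary[OF min_xw h' k'] LIMSEQ_const_iff)
  qed
  show "DL A' B' x' w' E F = 0" for E F
  proof -
    \<comment> \<open>The sum is written as a difference with \<open>- F\<close> to fit
      \<open>L2_lim_diff\<close>.\<close>
    have Fv: "L2_lim T (\<lambda>k t. E *v x (r k) t - (- F) *v v t) (\<lambda>t. E *v x' t - (- F) *v v t)"
      by (intro L2_lim_diff L2_lim_matrix tendsto_const xl L2_lim_const v)
    then have Fv: "L2_lim T (\<lambda>k t. E *v x (r k) t + F *v v t) (\<lambda>t. E *v x' t + F *v v t)"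
      by (simp add: matrix_vector_mult_uminus)
    have "(\<lambda>k. DL (A (Suc (r k))) (B (Suc (r k))) (x (r k)) (w (r k)) E F) \<longlonglongrightarrow> DL A' B' x' w' E F"
      unfolding DL_def by (intro tendsto_intros A1 B1 L2_lim_inner resl[OF A1 B1] Fv)
    then show ?thesis
      by (simp add: L_min_stationary[OF min_AB iterate_spaces] LIMSEQ_const_iff)
  qed
qed

end

theorem theorem5p1:
  fixes T \<alpha> \<beta> :: real
    and A0 :: "real^'n^'n" and B0 :: "real^'d^'n" and G :: "real^'m^'n" and C :: "real^'n^'p"
    and x0 :: "real^'n" and \<Pi>0 :: "real^'n^'n" and Q :: "real^'m^'m" and R :: "real^'p^'p"
    and v :: "real \<Rightarrow> real^'d" and y :: "real \<Rightarrow> real^'p"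
    and A :: "nat \<Rightarrow> real^'n^'n" and B :: "nat \<Rightarrow> real^'d^'n"
    and x :: "nat \<Rightarrow> real \<Rightarrow> real^'n" and w :: "nat \<Rightarrow> real \<Rightarrow> real^'m"
    and Z :: "nat \<Rightarrow> ('n, 'd, 'm) quad"
  assumes "0 < T" and "0 < \<alpha>" and "0 < \<beta>"
    and "covariance_matrix \<Pi>0" and "invertible \<Pi>0"
    and "covariance_matrix Q" and "invertible Q"
    and "covariance_matrix R" and "invertible R"
    and "v \<in> L2_space T" and "y \<in> L2_space T"
    and Z: "\<And>n. Z n = (A n, B n, x n, w n)"
    and init: "A 0 = A0" "B 0 = B0"
    and step_xw: "\<And>n. is_unique_minimizer (same_state_noise T)
          (\<lambda>(x', w'). K_functional T \<beta> G C x0 \<Pi>0 Q R v y (A n, B n, x', w'))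
          (H1_space T \<times> L2_space T) (x n, w n)"
    and step_AB: "\<And>n. is_unique_minimizer (=)
          (\<lambda>(A', B'). L_functional T \<alpha> \<beta> A0 B0 G v (A', B', x n, w n))
          UNIV (A (Suc n), B (Suc n))"
  shows "(\<forall>n. J_functional T \<alpha> \<beta> A0 B0 G C x0 \<Pi>0 Q R v y (Z (Suc n))
               \<le> J_functional T \<alpha> \<beta> A0 B0 G C x0 \<Pi>0 Q R v y (Z n))
    \<and> ((\<exists>M. \<forall>n. Z_norm T (Z n) \<le> M) \<and>
       (\<lambda>n. Z_norm T (Z (Suc n) - Z n)) \<longlonglongrightarrow> 0)
    \<and> (\<forall>Zhat\<in>Z_space T. \<forall>r::nat \<Rightarrow> nat.
         strict_mono r \<and> (\<lambda>k. Z_norm T (Z (r k) - Zhat)) \<longlonglongrightarrow> 0 \<longrightarrow>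
         optimality_conditions T \<alpha> \<beta> A0 B0 G C x0 \<Pi>0 Q R v y Zhat)"
proof -
  interpret alternating_minimization T \<alpha> \<beta> A0 B0 G C x0 \<Pi>0 Q R v y A B x w
    using assms(1-11) step_xw step_AB by unfold_locales (auto simp: is_unique_minimizer_def)
  have "Z (Suc n) - Z n = (A (Suc n) - A n, B (Suc n) - B n, dx n, dw n)" for n
    by (simp add: Z dx_def dw_def fun_diff_def)
  moreover have "optimality_conditions T \<alpha> \<beta> A0 B0 G C x0 \<Pi>0 Q R v y Zhat"
    if "Zhat \<in> Z_space T" "strict_mono r" "(\<lambda>k. Z_norm T (Z (r k) - Zhat)) \<longlonglongrightarrow> 0" for Zhat r
  proof -
    obtain A' B' x' w' where Zh: "Zhat = (A', B', x', w')" by (cases Zhat)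
    show ?thesis
      unfolding Zh by (rule limit_optimality[OF _ _ that(2)])
        (use that(1,3) in \<open>simp_all add: Zh Z Z_space_def fun_diff_def\<close>)
  qed
  ultimately show ?thesis
    using cost_decreasing Z_norm_bounded Z_norm_increment_tendsto_0 by (auto simp: Z cost_def)
qed

end
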